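(* The twisted knot invariant $K\mapsto Q^{z}_{K}(s,t)\in\mathbb{Z}[s,t]$ is a Vassiliev invariant of order one.
   Context: Twisted knot diagrams. An oriented twisted knot diagram $K$ is a generic immersed oriented closed curve in $\mathbb{R}^2$ with finitely many transverse double points, each marked either as a classical crossing (with over/under information) or as a virtual crossing (no over/under information), together with finitely many bars (short transverse marks) on the curve away from the double points. $C(K)$ is the set of classical crossings and $sgn(c)=sign(c)\in\{+1,-1\}$ is the usual sign of $c\in C(K)$. Vassiliev invariants. A singular twisted knot diagram is a twisted knot diagram in which finitely many double points are additionally allowed to be marked as singular crossings. A twisted knot invariant $v$ with values in an abelian group is extended to singular diagrams by the Vassiliev skein relation $v(K(\times))=v(K(\times^{+}))-v(K(\times^{-}))$, where $K(\times^{+})$ and $K(\times^{-})$ are obtained from $K(\times)$ by replacing the singular crossing $\times$ by a positive, respectively negative, classical crossing (applied repeatedly if there are several singular crossings). $v$ is of order $\le n$ if its extension vanishes on every singular twisted knot diagram with more than $n$ singular crossings; $v$ has order one if it is of order $\le 1$ and its extension is nonzero on some singular twisted knot diagram with exactly one singular crossing. Smoothing. For $c\in C(K)$, let $K_c$ be the two-component diagram obtained by the oriented smoothing at $c$, its components labelled $0$ and $1$ (which component gets which label does not affect the definitions of $ZC(K)$, $z$ and $Q^z$). Affine index. For $l\in\{0,1\}$, traverse the $l$-component of $K_c$ once along its orientation starting near $c$, and let $\gamma_1,\dots,\gamma_{k_l}$ be the sequence of classical crossings met (with repetition). Put $\epsilon_i=0$ if the traversal passes under at $\gamma_i$ and $\epsilon_i=1$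 if it passes over. Then $ind^{\,l}(c,K)=\sum_{i=1}^{k_l}(-1)^{\epsilon_i}sign(\gamma_i)$. (Self-crossings of the $l$-component contribute zero, and $ind^{\,1}(c,K)=-ind^{\,0}(c,K)$.) Zero crossings. $c\in C(K)$ is a zero crossing if $ind^{\,l}(c,K)$ is even for $l=0$ or $1$ (equivalently both). $ZC(K)$ is the set of zero crossings. For $c\in ZC(K)$ the zero affine index is $zind^{\,l}(c,K)=\sum_{\gamma_i\in ZC(K)}(-1)^{\epsilon_i}sign(\gamma_i)$, the sum being over those terms of the sequence $\gamma_1,\dots,\gamma_{k_l}$ of classical crossings met along the $l$-component of $K_c$ that are zero crossings of $K$, and $z(c)\in\{0,1\}$ is the residue of $zind^{\,l}(c,K)$ mod $2$ (independent of $l$). Bar parity. For $c\in C(K)$, $p^l(c)\in\{0,1\}$ is the parity of the number of bars on the $l$-component of $K_c$. The polynomial (for non-singular diagrams). $$Q^{z}_{K}(s,t)=\sum_{c\in ZC(K)}sgn(c)\bigl(s^{z(c)}t^{p^{0}(c)}-1\bigr)\bigl(s^{z(c)}t^{p^{1}(c)}-1\bigr)+\sum_{c\in C(K)\setminus ZC(K)}sgn(c)\bigl(s\,t^{p^{0}(c)}-1\bigr)\bigl(s\,t^{p^{1}(c)}-1\bigr).$$ It is an invariant of twisted knots, i.e. unchanged under the classical, virtual and twisted Reidemeister moves. *)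

theory Defs
  imports "HOL-Analysis.Analysis" "HOL-Computational_Algebra.Polynomial"
begin

section \<open>Diagrams\<close>

text \<open>
  The plane is the type \<open>complex\<close>. An oriented closed curve is a map on the reals of period 1, and
  its points are named by their times in the interval from 0 (included) to 1 (excluded).
  A classical crossing carries the time at which the curve passes over; a mark at a point that is
  not a double point has no meaning.
\<close>

datatype marking = Classical real | Virtual | Singular

record diagram =
  curve :: "real \<Rightarrow> complex"
  mark :: "complex \<Rightarrow> marking"
  bars :: "real set"

definition passages :: "diagram \<Rightarrow> complex \<Rightarrow> real set" where
  "passages K x = {t \<in> {0..<1}. curve K t = x}"

definition double_points :: "diagram \<Rightarrow> complex set" where
  "double_points K = {x. card (passages K x) = 2}"

definition velocity :: "diagram \<Rightarrow> real \<Rightarrow> complex" where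
  "velocity K t = vector_derivative (curve K) (at t)"

text \<open>The determinant of two vectors of the plane.\<close>

definition wedge :: "complex \<Rightarrow> complex \<Rightarrow> real" where
  "wedge a b = Re a * Im b - Im a * Re b"

definition singular_twisted_knot_diagram :: "diagram \<Rightarrow> bool" where
  "singular_twisted_knot_diagram K \<longleftrightarrow>
     (\<forall>t. curve K (t + 1) = curve K t) \<and>
     curve K C1_differentiable_on UNIV \<and>
     (\<forall>t. velocity K t \<noteq> 0) \<and>
     (\<forall>x. finite (passages K x) \<and> card (passages K x) \<le> 2) \<and>
     finite (double_points K) \<and>
     (\<forall>x \<in> double_points K. \<forall>t \<in> passages K x. \<forall>t' \<in> passages K x.
        t \<noteq> t' \<longrightarrow> wedge (velocity K t) (velocity K t') \<noteq> 0) \<and>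
     (\<forall>x \<in> double_points K. \<forall>u. mark K x = Classical u \<longrightarrow> u \<in> passages K x) \<and>
     finite (bars K) \<and> bars K \<subseteq> {0..<1} \<and>
     (\<forall>t \<in> bars K. curve K t \<notin> double_points K)"

definition classical_crossings :: "diagram \<Rightarrow> complex set" where
  "classical_crossings K = {x \<in> double_points K. \<exists>u. mark K x = Classical u}"

definition singular_crossings :: "diagram \<Rightarrow> complex set" where
  "singular_crossings K = {x \<in> double_points K. mark K x = Singular}"

definition twisted_knot_diagram :: "diagram \<Rightarrow> bool" where
  "twisted_knot_diagram K \<longleftrightarrow> singular_twisted_knot_diagram K \<and> singular_crossings K = {}"

text \<open>
  A classical crossing is positive if the over direction followed by the under direction is a
  positive basis of the plane.
\<close>

definition crossing_sign :: "diagram \<Rightarrow> complex \<Rightarrow> int" where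
  "crossing_sign K x =
     (case mark K x of
        Classical u \<Rightarrow>
          (if wedge (velocity K u) (velocity K (THE t. t \<in> passages K x \<and> t \<noteq> u)) > 0 then 1 else -1)
      | _ \<Rightarrow> 0)"


section \<open>Smoothing, indices and the polynomial\<close>

text \<open>
  The oriented smoothing at a double point \<open>c\<close>, passed at the times \<open>u < v\<close>, separates the curve
  into the part traversed between \<open>u\<close> and \<open>v\<close> (component 0) and the part traversed from \<open>v\<close>
  through the base point back to \<open>u\<close> (component 1). A component is given by the set of times of
  its traversal; \<open>c\<close> itself is not met any more.
\<close>

definition component :: "diagram \<Rightarrow> nat \<Rightarrow> complex \<Rightarrow> real set" where
  "component K l c =
     (let u = Min (passages K c); v = Max (passages K c)
      in if l = 0 then {u<..<v} else {0..<u} \<union> {v<..<1})"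

definition over_passage :: "diagram \<Rightarrow> real \<Rightarrow> nat" where
  "over_passage K t = (if mark K (curve K t) = Classical t then 1 else 0)"

text \<open>
  The sum over the sequence of crossings met (with repetition) is a sum over the times at which a
  crossing is met. The set \<open>X\<close> selects the crossings that count.
\<close>

definition index_sum :: "diagram \<Rightarrow> complex set \<Rightarrow> nat \<Rightarrow> complex \<Rightarrow> int" where
  "index_sum K X l c =
     (\<Sum>t \<in> {t \<in> component K l c. curve K t \<in> X}.
        (-1) ^ over_passage K t * crossing_sign K (curve K t))"

definition ind :: "diagram \<Rightarrow> nat \<Rightarrow> complex \<Rightarrow> int" where
  "ind K l c = index_sum K (classical_crossings K) l c"

definition zero_crossings :: "diagram \<Rightarrow> complex set" where
  "zero_crossings K = {c \<in> classical_crossings K. \<exists>l \<in> {0, 1}. even (ind K l c)}"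

definition zind :: "diagram \<Rightarrow> nat \<Rightarrow> complex \<Rightarrow> int" where
  "zind K l c = index_sum K (zero_crossings K) l c"

definition zero_parity :: "diagram \<Rightarrow> complex \<Rightarrow> nat" where
  "zero_parity K c = nat (zind K 0 c mod 2)"

definition bar_parity :: "diagram \<Rightarrow> nat \<Rightarrow> complex \<Rightarrow> nat" where
  "bar_parity K l c = card (bars K \<inter> component K l c) mod 2"

text \<open>The ring of integer polynomials in \<open>s\<close> and \<open>t\<close>, as polynomials in \<open>t\<close> over those in \<open>s\<close>.\<close>

definition var_s :: "int poly poly" where
  "var_s = [:[:0, 1:]:]"

definition var_t :: "int poly poly" where
  "var_t = [:0, 1:]"

definition Qz :: "diagram \<Rightarrow> int poly poly" where
  "Qz K =
     (\<Sum>c \<in> zero_crossings K.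
        of_int (crossing_sign K c) *
        (var_s ^ zero_parity K c * var_t ^ bar_parity K 0 c - 1) *
        (var_s ^ zero_parity K c * var_t ^ bar_parity K 1 c - 1)) +
     (\<Sum>c \<in> classical_crossings K - zero_crossings K.
        of_int (crossing_sign K c) *
        (var_s * var_t ^ bar_parity K 0 c - 1) *
        (var_s * var_t ^ bar_parity K 1 c - 1))"


section \<open>Twisted knot invariants\<close>

text \<open>
  The diagrams \<open>K\<close> and \<open>K'\<close> agree outside the closed disc \<open>B\<close>, and both enter \<open>B\<close> exactly during
  the disjoint time intervals in the list \<open>As\<close>. No interval contains the base point; this
  is no restriction, since the parametrization may be changed.
\<close>

definition local_change :: "complex set \<Rightarrow> real set list \<Rightarrow> diagram \<Rightarrow> diagram \<Rightarrow> bool" where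
  "local_change B As K K' \<longleftrightarrow>
     B homeomorphic (cball 0 1 :: complex set) \<and>
     (\<forall>i < length As. \<forall>j < length As. i \<noteq> j \<longrightarrow> As ! i \<inter> As ! j = {}) \<and>
     (\<forall>A \<in> set As. \<exists>a b. 0 < a \<and> a < b \<and> b < 1 \<and> A = {a..b} \<and>
        (\<forall>L \<in> {K, K'}. curve L a \<in> frontier B \<and> curve L b \<in> frontier B \<and>
           curve L ` {a<..<b} \<subseteq> interior B)) \<and>
     (\<forall>L \<in> {K, K'}. {t \<in> {0..<1}. curve L t \<in> B} = \<Union> (set As)) \<and>
     (\<forall>t \<in> {0..<1} - \<Union> (set As). curve K' t = curve K t) \<and>
     (\<forall>x \<in> double_points K - B. mark K' x = mark K x) \<and>
     bars K' - \<Union> (set As) = bars K - \<Union> (set As)"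

definition no_bars :: "diagram \<Rightarrow> real set list \<Rightarrow> bool" where
  "no_bars K As \<longleftrightarrow> bars K \<inter> \<Union> (set As) = {}"

text \<open>
  The moves below are given in one direction; invariance under a move is symmetric. The
  conditions on signs hold automatically for the tangles in question, they just make the pictures
  explicit.
\<close>

definition reidemeister1 :: "diagram \<Rightarrow> diagram \<Rightarrow> bool" where
  "reidemeister1 K K' \<longleftrightarrow>
     (\<exists>B A x. local_change B [A] K K' \<and> no_bars K [A] \<and> no_bars K' [A] \<and>
        double_points K \<inter> B = {} \<and> double_points K' \<inter> B = {x} \<and>
        x \<in> classical_crossings K')"

definition virtual1 :: "diagram \<Rightarrow> diagram \<Rightarrow> bool" where
  "virtual1 K K' \<longleftrightarrow>
     (\<exists>B A x. local_change B [A] K K' \<and> no_bars K [A] \<and> no_bars K' [A] \<and>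
        double_points K \<inter> B = {} \<and> double_points K' \<inter> B = {x} \<and>
        mark K' x = Virtual)"

text \<open>Two arcs without crossings in \<open>K\<close>; in \<open>K'\<close> they cross at the points \<open>x\<close> and \<open>y\<close>, which the
  first arc passes at the times \<open>t\<close> and \<open>s\<close>.\<close>

definition bigon :: "complex set \<Rightarrow> real set list \<Rightarrow> real \<Rightarrow> real \<Rightarrow> diagram \<Rightarrow> diagram \<Rightarrow> bool" where
  "bigon B As t s K K' \<longleftrightarrow>
     (\<exists>A0 A1. As = [A0, A1] \<and> local_change B As K K' \<and> no_bars K As \<and> no_bars K' As \<and>
        double_points K \<inter> B = {} \<and>
        t \<in> A0 \<and> s \<in> A0 \<and> curve K' t \<noteq> curve K' s \<and>
        curve K' t \<in> curve K' ` A1 \<and> curve K' s \<in> curve K' ` A1 \<and>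
        double_points K' \<inter> B = {curve K' t, curve K' s})"

definition reidemeister2 :: "diagram \<Rightarrow> diagram \<Rightarrow> bool" where
  "reidemeister2 K K' \<longleftrightarrow>
     (\<exists>B As t s. bigon B As t s K K' \<and>
        mark K' (curve K' t) = Classical t \<and> mark K' (curve K' s) = Classical s \<and>
        crossing_sign K' (curve K' t) = - crossing_sign K' (curve K' s))"

definition virtual2 :: "diagram \<Rightarrow> diagram \<Rightarrow> bool" where
  "virtual2 K K' \<longleftrightarrow>
     (\<exists>B As t s. bigon B As t s K K' \<and>
        mark K' (curve K' t) = Virtual \<and> mark K' (curve K' s) = Virtual)"

text \<open>
  Three arcs that cross pairwise, each pair once; \<open>s i j\<close> is the time at which arc \<open>i\<close> passes its
  crossing with arc \<open>j\<close>.
\<close>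

definition triangle :: "complex set \<Rightarrow> real set list \<Rightarrow> (nat \<Rightarrow> nat \<Rightarrow> real) \<Rightarrow> diagram \<Rightarrow> bool" where
  "triangle B As s K \<longleftrightarrow>
     length As = 3 \<and> no_bars K As \<and>
     (\<forall>i < 3. \<forall>j < 3. i \<noteq> j \<longrightarrow> s i j \<in> As ! i \<and> curve K (s i j) = curve K (s j i)) \<and>
     double_points K \<inter> B = {curve K (s 0 1), curve K (s 0 2), curve K (s 1 2)}"

text \<open>An arc is moved across the crossing of the other two: the two crossings on
  each arc change their order.\<close>

definition triangle_move ::
  "complex set \<Rightarrow> real set list \<Rightarrow> (nat \<Rightarrow> nat \<Rightarrow> real) \<Rightarrow> (nat \<Rightarrow> nat \<Rightarrow> real) \<Rightarrow> diagram \<Rightarrow> diagram \<Rightarrow> bool"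
  where
  "triangle_move B As s s' K K' \<longleftrightarrow>
     local_change B As K K' \<and> triangle B As s K \<and> triangle B As s' K' \<and>
     (\<forall>i < 3. \<forall>j < 3. \<forall>k < 3. i \<noteq> j \<and> i \<noteq> k \<and> j \<noteq> k \<longrightarrow>
        (s i j < s i k \<longleftrightarrow> s' i k < s' i j))"

text \<open>The arcs are listed from top to bottom.\<close>

definition reidemeister3 :: "diagram \<Rightarrow> diagram \<Rightarrow> bool" where
  "reidemeister3 K K' \<longleftrightarrow>
     (\<exists>B As s s'. triangle_move B As s s' K K' \<and>
        (\<forall>(i, j) \<in> {(0, 1), (0, 2), (1, 2)}.
           mark K (curve K (s i j)) = Classical (s i j) \<and>
           mark K' (curve K' (s' i j)) = Classical (s' i j) \<and>
           crossing_sign K (curve K (s i j)) = crossing_sign K' (curve K' (s' i j))))"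

definition virtual3 :: "diagram \<Rightarrow> diagram \<Rightarrow> bool" where
  "virtual3 K K' \<longleftrightarrow>
     (\<exists>B As s s'. triangle_move B As s s' K K' \<and>
        (\<forall>(i, j) \<in> {(0, 1), (0, 2), (1, 2)}.
           mark K (curve K (s i j)) = Virtual \<and> mark K' (curve K' (s' i j)) = Virtual))"

definition virtual4 :: "diagram \<Rightarrow> diagram \<Rightarrow> bool" where
  "virtual4 K K' \<longleftrightarrow>
     (\<exists>B As s s'. triangle_move B As s s' K K' \<and>
        mark K (curve K (s 0 1)) = Classical (s 0 1) \<and>
        mark K' (curve K' (s' 0 1)) = Classical (s' 0 1) \<and>
        crossing_sign K (curve K (s 0 1)) = crossing_sign K' (curve K' (s' 0 1)) \<and>
        (\<forall>(i, j) \<in> {(0, 2), (1, 2)}.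
           mark K (curve K (s i j)) = Virtual \<and> mark K' (curve K' (s' i j)) = Virtual))"

text \<open>A bar is moved across a virtual crossing.\<close>

definition twisted1 :: "diagram \<Rightarrow> diagram \<Rightarrow> bool" where
  "twisted1 K K' \<longleftrightarrow>
     curve K' = curve K \<and> mark K' = mark K \<and>
     (\<exists>a b r. 0 \<le> a \<and> a < b \<and> b < 1 \<and>
        {t \<in> {a..b}. curve K t \<in> double_points K} = {r} \<and> mark K (curve K r) = Virtual \<and>
        bars K \<inter> {a..b} = {a} \<and> bars K' = insert b (bars K - {a}))"

text \<open>Two neighbouring bars are created.\<close>

definition twisted2 :: "diagram \<Rightarrow> diagram \<Rightarrow> bool" where
  "twisted2 K K' \<longleftrightarrow>
     curve K' = curve K \<and> mark K' = mark K \<and>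
     (\<exists>a b. 0 \<le> a \<and> a < b \<and> b < 1 \<and>
        {t \<in> {a..b}. curve K t \<in> double_points K} = {} \<and>
        bars K \<inter> {a..b} = {} \<and> bars K' = bars K \<union> {a, b})"

text \<open>
  A classical crossing with a bar on each of its four legs, in \<open>K\<close>, is replaced by a classical
  crossing between two virtual ones, in \<open>K'\<close>. The arc that was over becomes the arc that is under,
  and since the two arcs have changed sides at the classical crossing its sign is the same.
\<close>

definition twisted3 :: "diagram \<Rightarrow> diagram \<Rightarrow> bool" where
  "twisted3 K K' \<longleftrightarrow>
     (\<exists>B A0 A1 t0 t1 a0 b0 a1 b1 p0 q0 r0 p1 q1 r1.
        local_change B [A0, A1] K K' \<and>
        t0 \<in> A0 \<and> t1 \<in> A1 \<and> curve K t0 = curve K t1 \<and>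
        double_points K \<inter> B = {curve K t0} \<and> mark K (curve K t0) = Classical t0 \<and>
        bars K \<inter> A0 = {a0, b0} \<and> a0 < t0 \<and> t0 < b0 \<and>
        bars K \<inter> A1 = {a1, b1} \<and> a1 < t1 \<and> t1 < b1 \<and>
        no_bars K' [A0, A1] \<and>
        {p0, q0, r0} \<subseteq> A0 \<and> p0 < q0 \<and> q0 < r0 \<and>
        {p1, q1, r1} \<subseteq> A1 \<and> (p1 < q1 \<and> q1 < r1 \<or> r1 < q1 \<and> q1 < p1) \<and>
        curve K' p0 = curve K' p1 \<and> curve K' q0 = curve K' q1 \<and> curve K' r0 = curve K' r1 \<and>
        double_points K' \<inter> B = {curve K' p0, curve K' q0, curve K' r0} \<and>
        mark K' (curve K' p0) = Virtual \<and> mark K' (curve K' r0) = Virtual \<and>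
        mark K' (curve K' q0) = Classical q1 \<and>
        crossing_sign K' (curve K' q0) = crossing_sign K (curve K t0))"

text \<open>A planar isotopy, described by the orientation preserving diffeomorphism at its end.\<close>

definition plane_isotopy :: "diagram \<Rightarrow> diagram \<Rightarrow> bool" where
  "plane_isotopy K K' \<longleftrightarrow>
     (\<exists>\<phi> \<phi>'. bij \<phi> \<and> (\<forall>x. (\<phi> has_derivative \<phi>' x) (at x)) \<and>
        (\<forall>h. continuous_on UNIV (\<lambda>x. \<phi>' x h)) \<and>
        (\<forall>x. wedge (\<phi>' x 1) (\<phi>' x \<i>) > 0) \<and>
        curve K' = \<phi> \<circ> curve K \<and> bars K' = bars K \<and>
        (\<forall>x \<in> double_points K. mark K' (\<phi> x) = mark K x))"

definition reparametrization :: "diagram \<Rightarrow> diagram \<Rightarrow> bool" where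
  "reparametrization K K' \<longleftrightarrow>
     (\<exists>\<rho> \<rho>'. (\<forall>t. (\<rho> has_real_derivative \<rho>' t) (at t)) \<and> continuous_on UNIV \<rho>' \<and>
        (\<forall>t. \<rho>' t > 0) \<and> (\<forall>t. \<rho> (t + 1) = \<rho> t + 1) \<and>
        curve K' = curve K \<circ> \<rho> \<and>
        bars K' = {t \<in> {0..<1}. frac (\<rho> t) \<in> bars K} \<and>
        (\<forall>x \<in> double_points K.
           mark K x = (case mark K' x of Classical u \<Rightarrow> Classical (frac (\<rho> u)) | m \<Rightarrow> m)))"

definition twisted_move :: "diagram \<Rightarrow> diagram \<Rightarrow> bool" where
  "twisted_move K K' \<longleftrightarrow>
     plane_isotopy K K' \<or> reparametrization K K' \<or>
     reidemeister1 K K' \<or> reidemeister2 K K' \<or> reidemeister3 K K' \<or>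
     virtual1 K K' \<or> virtual2 K K' \<or> virtual3 K K' \<or> virtual4 K K' \<or>
     twisted1 K K' \<or> twisted2 K K' \<or> twisted3 K K'"

definition twisted_knot_invariant :: "(diagram \<Rightarrow> 'a) \<Rightarrow> bool" where
  "twisted_knot_invariant v \<longleftrightarrow>
     (\<forall>K K'. twisted_knot_diagram K \<and> twisted_knot_diagram K' \<and> twisted_move K K' \<longrightarrow> v K = v K')"


section \<open>Vassiliev invariants\<close>

text \<open>The double point \<open>x\<close> becomes a classical crossing with the passage at time \<open>u\<close> over.\<close>

definition resolve :: "diagram \<Rightarrow> complex \<Rightarrow> real \<Rightarrow> diagram" where
  "resolve K x u = K\<lparr>mark := (mark K)(x := Classical u)\<rparr>"

text \<open>
  On singular twisted knot diagrams \<open>w\<close> is the extension of \<open>v\<close> by the skein relation, which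
  determines it there by induction on the number of singular crossings.
\<close>

definition vassiliev_extension :: "(diagram \<Rightarrow> 'a::ab_group_add) \<Rightarrow> (diagram \<Rightarrow> 'a) \<Rightarrow> bool" where
  "vassiliev_extension v w \<longleftrightarrow>
     (\<forall>K. twisted_knot_diagram K \<longrightarrow> w K = v K) \<and>
     (\<forall>K x u u'.
        singular_twisted_knot_diagram K \<and> x \<in> singular_crossings K \<and> passages K x = {u, u'} \<and>
        crossing_sign (resolve K x u) x = 1 \<and> crossing_sign (resolve K x u') x = -1 \<longrightarrow>
        w K = w (resolve K x u) - w (resolve K x u'))"

definition vassiliev_order_le :: "nat \<Rightarrow> (diagram \<Rightarrow> 'a::ab_group_add) \<Rightarrow> bool" where
  "vassiliev_order_le n v \<longleftrightarrow>
     (\<exists>w. vassiliev_extension v w \<and>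
        (\<forall>K. singular_twisted_knot_diagram K \<and> card (singular_crossings K) > n \<longrightarrow> w K = 0))"

definition vassiliev_invariant_of_order_one :: "(diagram \<Rightarrow> 'a::ab_group_add) \<Rightarrow> bool" where
  "vassiliev_invariant_of_order_one v \<longleftrightarrow>
     twisted_knot_invariant v \<and> vassiliev_order_le 1 v \<and>
     (\<exists>w. vassiliev_extension v w \<and>
        (\<exists>K. singular_twisted_knot_diagram K \<and> card (singular_crossings K) = 1 \<and> w K \<noteq> 0))"

end

(*
  The argument is a parity count. Since signs are odd, the parities of the affine indices depend only
  on the interlacement graph of the classical crossings: a crossing is a zero crossing iff its degree
  is even, and z(c) is the parity of the number of its neighbours among the zero crossings. Every local
  move changes this graph in a way that preserves the relevant parities; a third Reidemeister move
  complements a triangle whose three degrees have an even sum and whose vertices have together an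
  even number of edges to each other vertex. As the two factors of the term of c do not
  depend on which strand is over, changing a crossing only changes the sign of its own term. Hence the
  first derivative on a singular crossing is twice its term, the second derivative vanishes, and
  a figure eight with a bar on each loop has the derivative 2 (t - 1)^2.
*)
theory Submission
  imports Defs
begin

section \<open>Parity of finite sets\<close>

text \<open>The number \<open>z(c)\<close> is a parity on two levels: it counts only neighbours of
  even degree, so a move could alter it at crossings far from the disc. The third Reidemeister move
  is where this matters. There each vertex of the triangle sees two links flip, so its degree keeps
  its parity; but its count of even neighbours keeps its parity only if the other two vertices are
  both even or both odd. The even degree sum forces this exactly when the vertex itself is even, the
  only case in which \<open>z\<close> is defined. A crossing of odd degree has the constant exponent
  1 of \<open>s\<close> instead. The subtraction of 1 in both factors takes care of the first move:
  a kink is isolated in the graph and its loop carries no bar, so one factor is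
  \<open>1 - 1\<close>. The second move creates two crossings with the same neighbours and bar
  parities but opposite signs, and their terms cancel. Moving the base point may exchange the two
  components of a smoothing; the symmetry of each term in the two bar parities absorbs this.\<close>

lemma even_card_iff_sym_diff:
  assumes "finite A" "finite B" "even (card ((A - B) \<union> (B - A)))"
  shows "even (card A) \<longleftrightarrow> even (card B)"
proof -
  have "card A = card (A - B) + card (A \<inter> B)" "card B = card (B - A) + card (A \<inter> B)"
    using assms(1,2) by (metis card_Diff_subset_Int card_Int_Diff finite_Int inf_commute add.commute)+
  moreover have "card ((A - B) \<union> (B - A)) = card (A - B) + card (B - A)"
    using assms(1,2) by (intro card_Un_disjoint) auto
  ultimately show ?thesis
    using assms(3) by presburger
qed

lemma card_pair_filter:
  assumes "x \<noteq> y"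
  shows "card {d \<in> {x, y}. P d} = of_bool (P x) + of_bool (P y)"
proof -
  have "{d \<in> {x, y}. P d} = (if P x then {x} else {}) \<union> (if P y then {y} else {})"
    by auto
  then show ?thesis
    using assms by auto
qed

lemma card_triple_filter:
  assumes "x \<noteq> y" "x \<noteq> z" "y \<noteq> z"
  shows "card {d \<in> {x, y, z}. P d} = of_bool (P x) + (of_bool (P y) + of_bool (P z))"
proof -
  have "{d \<in> {x, y, z}. P d} = (if P x then {x} else {}) \<union> {d \<in> {y, z}. P d}"
    by auto
  moreover have "card \<dots> = card (if P x then {x} else {}) + card {d \<in> {y, z}. P d}"
    using assms by (intro card_Un_disjoint) auto
  ultimately show ?thesis
    by (simp only: card_pair_filter[OF assms(3)]) simp
qed

lemma card_Un_filter:
  assumes "finite A" "finite B" "A \<inter> B = {}"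
  shows "card {d \<in> A \<union> B. P d} = card {d \<in> A. P d} + card {d \<in> B. P d}"
proof -
  have "{d \<in> A \<union> B. P d} = {d \<in> A. P d} \<union> {d \<in> B. P d}"
    by auto
  then show ?thesis
    using assms by (simp add: card_Un_disjoint disjoint_iff)
qed


section \<open>Exponents determined by a graph\<close>

definition even_vertices :: "'a set \<Rightarrow> ('a \<Rightarrow> 'a \<Rightarrow> bool) \<Rightarrow> 'a set" where
  "even_vertices C L = {c \<in> C. even (card {d \<in> C. L c d})}"

text \<open>The default value 1 is the fixed exponent of \<open>s\<close> in the second sum of
  \<open>Qz\<close>, so that one function of the graph serves both sums.\<close>

definition exponent :: "'a set \<Rightarrow> ('a \<Rightarrow> 'a \<Rightarrow> bool) \<Rightarrow> 'a \<Rightarrow> nat" where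
  "exponent C L c =
     (if c \<in> even_vertices C L then card {d \<in> even_vertices C L. L c d} mod 2 else 1)"

lemma finite_even_vertices: "finite C \<Longrightarrow> finite (even_vertices C L)"
  by (simp add: even_vertices_def)

lemma exponent_eqI:
  assumes "c \<in> even_vertices C L \<longleftrightarrow> c' \<in> even_vertices C' L'"
    and "c \<in> even_vertices C L \<Longrightarrow> even (card {d \<in> even_vertices C L. L c d}) \<longleftrightarrow>
           even (card {d \<in> even_vertices C' L'. L' c' d})"
  shows "exponent C L c = exponent C' L' c'"
  using assms unfolding exponent_def by (simp add: mod2_eq_if)

text \<open>
  The set \<open>T\<close> is empty for an isomorphism and consists of the three crossings of a
  third Reidemeister move otherwise; such a move complements the edges inside \<open>T\<close>.
\<close>

lemma exponent_transfer:
  fixes L :: "'a \<Rightarrow> 'a \<Rightarrow> bool" and L' :: "'b \<Rightarrow> 'b \<Rightarrow> bool"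
  assumes fin: "finite C" and bij: "bij_betw F C C'" and TC: "T \<subseteq> C"
    and T: "T = {} \<or> card T = 3"
    and sym: "\<And>c d. c \<in> C \<Longrightarrow> d \<in> C \<Longrightarrow> L c d \<Longrightarrow> L d c"
    and irr: "\<And>c. c \<in> C \<Longrightarrow> \<not> L c c"
    and ev: "\<And>c. c \<in> C - T \<Longrightarrow> even (card {t \<in> T. L c t})"
    and L': "\<And>c d. c \<in> C \<Longrightarrow> d \<in> C \<Longrightarrow> L' (F c) (F d) \<longleftrightarrow> (L c d \<noteq> (c \<in> T \<and> d \<in> T \<and> c \<noteq> d))"
    and c: "c \<in> C"
  shows "exponent C' L' (F c) = exponent C L c"
proof -
  have inj: "inj_on F C" and C': "C' = F ` C"
    using bij by (auto simp: bij_betw_def)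
  have finT: "finite T"
    using fin TC finite_subset by blast
  define N where "N X c = {d \<in> X. L c d}" for X c
  have card_image': "card {d \<in> F ` X. L' (F c) d} = card {d \<in> X. L' (F c) (F d)}"
    if "X \<subseteq> C" for X c
  proof -
    have "{d \<in> F ` X. L' (F c) d} = F ` {d \<in> X. L' (F c) (F d)}"
      by auto
    moreover have "inj_on F {d \<in> X. L' (F c) (F d)}"
      using inj that by (auto intro: inj_on_subset)
    ultimately show ?thesis
      by (simp add: card_image)
  qed
  \<comment> \<open>Passing from \<open>L\<close> to \<open>L'\<close> changes the neighbours of
    \<open>c\<close> in \<open>X\<close> by the part of \<open>T - {c}\<close> in \<open>X\<close>
    if \<open>c\<close> is in \<open>T\<close>, and not at all otherwise. This is applied to
    \<open>X = C\<close> for the degrees and to the even vertices for the exponents.\<close>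
  have step: "even (card {d \<in> F ` X. L' (F c) d}) \<longleftrightarrow> even (card (N X c))"
    if "X \<subseteq> C" "c \<in> C" "c \<in> T \<Longrightarrow> even (card ((T - {c}) \<inter> X))" for X c
  proof -
    have finX: "finite X"
      using fin that finite_subset by blast
    have "({d \<in> X. L' (F c) (F d)} - N X c) \<union> (N X c - {d \<in> X. L' (F c) (F d)})
      = (if c \<in> T then (T - {c}) \<inter> X else {})"
      using L' that(1,2) TC by (auto simp: N_def)
    then have "even (card {d \<in> X. L' (F c) (F d)}) \<longleftrightarrow> even (card (N X c))"
      using that finX by (intro even_card_iff_sym_diff) (auto simp: N_def)
    then show ?thesis
      using card_image' that by simp
  qed
  have "even (card {d \<in> C'. L' (F c) d}) \<longleftrightarrow> even (card (N C c))" if "c \<in> C" for c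
    unfolding C'
  proof (rule step)
    assume "c \<in> T"
    then have "card T = 3" using T by auto
    then have "card (T - {c}) = 2" using \<open>c \<in> T\<close> finT by simp
    moreover have "(T - {c}) \<inter> C = T - {c}" using TC by auto
    ultimately show "even (card ((T - {c}) \<inter> C))" by simp
  qed (use that in auto)
  then have EV: "even_vertices C' L' = F ` even_vertices C L"
    unfolding even_vertices_def using C' by (auto simp: N_def)
  let ?E = "even_vertices C L"
  have E: "?E \<subseteq> C" by (auto simp: even_vertices_def)
  show ?thesis
  proof (rule exponent_eqI)
    show iff: "F c \<in> even_vertices C' L' \<longleftrightarrow> c \<in> ?E"
      unfolding EV using inj E c by (auto dest: inj_onD)
    assume "F c \<in> even_vertices C' L'"
    then have cE: "c \<in> ?E" using iff by simp
    show "even (card {d \<in> even_vertices C' L'. L' (F c) d}) = even (card {d \<in> ?E. L c d})"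
      unfolding EV
    proof (subst step)
      show "?E \<subseteq> C" "c \<in> C" by fact+
      assume "c \<in> T"
      then have "card T = 3" using T by auto
      then have "card (T - {c}) = 2" using \<open>c \<in> T\<close> finT by simp
      then obtain x y where xy: "T - {c} = {x, y}" "x \<noteq> y"
        by (meson card_2_iff)
      then have Teq: "T = {c, x, y}" and ne: "x \<noteq> c" "y \<noteq> c" using \<open>c \<in> T\<close> by auto
      have inC: "x \<in> C" "y \<in> C" using Teq TC by auto
      have symm: "L a b = L b a" if "a \<in> C" "b \<in> C" for a b
        using sym that by blast
      have deg: "card (N C t) = card (N (C - T) t) + card (N T t)" if "t \<in> T" for t
      proof -
        have "(C - T) \<union> T = C" using TC by auto
        then show ?thesis
          unfolding N_def using card_Un_filter[of "C - T" T "L t"] fin finT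
          by (metis Diff_disjoint finite_Diff inf_commute)
      qed
      have NT: "card (N T t) = of_bool (L t c) + (of_bool (L t x) + of_bool (L t y))" for t
        unfolding Teq N_def by (rule card_triple_filter) (use xy ne in auto)
      \<comment> \<open>A vertex outside \<open>T\<close> sees an even number of \<open>c\<close>,
        \<open>x\<close>, \<open>y\<close>, so it sees \<open>y\<close> iff it sees exactly one of
        the other two. Outside \<open>T\<close> the neighbourhood of \<open>y\<close> is thus the
        symmetric difference of those of \<open>c\<close> and \<open>x\<close>, and the three sizes
        have an even sum.\<close>
      have "L y d = (L c d \<noteq> L x d)" if "d \<in> C - T" for d
        using ev[OF that] NT[of d] symm[of d] inC c that
        by (cases "L d c"; cases "L d x"; cases "L d y") (auto simp: N_def)
      then have "N (C - T) y = (N (C - T) c - N (C - T) x) \<union> (N (C - T) x - N (C - T) c)"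
        by (auto simp: N_def)
      moreover have "card \<dots> = card (N (C - T) c - N (C - T) x) + card (N (C - T) x - N (C - T) c)"
        using fin by (intro card_Un_disjoint) (auto simp: N_def)
      moreover have "card A = card (A - B) + card (A \<inter> B)" if "finite A" for A B :: "'a set"
        using that by (metis add.commute card_Int_Diff)
      from this[of "N (C - T) c" "N (C - T) x"] this[of "N (C - T) x" "N (C - T) c"]
      have "card (N (C - T) c) = card (N (C - T) c - N (C - T) x) + card (N (C - T) c \<inter> N (C - T) x)"
        "card (N (C - T) x) = card (N (C - T) x - N (C - T) c) + card (N (C - T) c \<inter> N (C - T) x)"
        using fin by (simp_all add: N_def Int_commute)
      ultimately have 1: "even (card (N (C - T) c) + card (N (C - T) x) + card (N (C - T) y))"
        by presburger
      \<comment> \<open>Inside \<open>T\<close> every edge is counted at both of its ends.\<close>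
      have "even (card (N T c) + card (N T x) + card (N T y))"
        using symm c inC irr unfolding NT by auto
      then have "even (card (N C c) + card (N C x) + card (N C y))"
        using 1 deg[of c] deg[of x] deg[of y] Teq by (simp add: ac_simps)
      moreover have "even (card (N C c))"
        using cE by (simp add: even_vertices_def N_def)
      ultimately have "x \<in> ?E \<longleftrightarrow> y \<in> ?E"
        using inC by (simp add: even_vertices_def N_def)
      then have "{x, y} \<inter> ?E = (if x \<in> ?E then {x, y} else {})" by auto
      then show "even (card ((T - {c}) \<inter> ?E))"
        using xy by simp
    qed (simp add: N_def)
  qed
qed

lemma exponent_cong:
  assumes "\<And>c d. c \<in> C \<Longrightarrow> d \<in> C \<Longrightarrow> L c d \<longleftrightarrow> L' c d" "c \<in> C"
  shows "exponent C L c = exponent C L' c"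
proof -
  have "{d \<in> C. L c d} = {d \<in> C. L' c d}" if "c \<in> C" for c
    using assms that by auto
  then have E: "even_vertices C L = even_vertices C L'"
    by (auto simp: even_vertices_def)
  have "{d \<in> even_vertices C L'. L c d} = {d \<in> even_vertices C L'. L' c d}"
    using assms by (auto simp: even_vertices_def)
  then show ?thesis
    by (simp add: exponent_def E)
qed

text \<open>A vertex without neighbours has even degree and so joins the even vertices, but it
  enters the count of no other vertex. This is the crossing of a kink.\<close>

lemma exponent_isolated:
  assumes x: "x \<notin> C"
    and L: "\<And>c. c \<in> insert x C \<Longrightarrow> \<not> L x c" "\<And>c. c \<in> C \<Longrightarrow> \<not> L c x"
  shows "exponent (insert x C) L x = 0"
    and "c \<in> C \<Longrightarrow> exponent (insert x C) L c = exponent C L c"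
proof -
  have "{d \<in> insert x C. L x d} = {}" using L by auto
  then have xE: "x \<in> even_vertices (insert x C) L" by (simp add: even_vertices_def del: Collect_empty_eq)
  have none: "{d \<in> even_vertices (insert x C) L. L x d} = {}"
    using L by (auto simp: even_vertices_def)
  show "exponent (insert x C) L x = 0"
    unfolding exponent_def using xE none by (simp del: Collect_empty_eq)
  have nb: "{d \<in> insert x C. L c d} = {d \<in> C. L c d}" if "c \<in> C" for c
    using L that by auto
  have E: "even_vertices (insert x C) L = insert x (even_vertices C L)"
    using nb xE x by (auto simp: even_vertices_def)
  show "exponent (insert x C) L c = exponent C L c" if "c \<in> C"
  proof -
    have "{d \<in> insert x (even_vertices C L). L c d} = {d \<in> even_vertices C L. L c d}" "c \<noteq> x"
      using L that x by auto
    then show ?thesis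
      by (simp add: exponent_def E)
  qed
qed

text \<open>An old vertex gains none or both of \<open>x\<close> and \<open>y\<close> as neighbours.
  The degrees of \<open>x\<close> and \<open>y\<close> have the same parity, so both or neither join
  the even vertices; hence every count at an old vertex grows by 0 or 2. The twins are the crossings
  of a second Reidemeister move, and they may be adjacent to each other.\<close>

lemma exponent_twins:
  assumes fin: "finite C" and xy: "x \<notin> C" "y \<notin> C" "x \<noteq> y"
    and L: "\<And>c. c \<in> C \<Longrightarrow> L c x \<longleftrightarrow> L c y" "\<And>c. c \<in> C \<Longrightarrow> L x c \<longleftrightarrow> L y c"
      "L x y \<longleftrightarrow> L y x" "\<not> L x x" "\<not> L y y"
  shows "exponent (C \<union> {x, y}) L x = exponent (C \<union> {x, y}) L y"
    and "c \<in> C \<Longrightarrow> exponent (C \<union> {x, y}) L c = exponent C L c"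
proof -
  let ?C = "C \<union> {x, y}"
  let ?E = "even_vertices ?C L"
  have "C \<inter> {x, y} = {}" using xy by auto
  from card_Un_filter[OF fin _ this]
  have split: "card {d \<in> ?C. L c d} = card {d \<in> C. L c d} + (of_bool (L c x) + of_bool (L c y))" for c
    by (simp only: card_pair_filter[OF xy(3)] finite_insert finite.emptyI simp_thms)
  have "{d \<in> C. L x d} = {d \<in> C. L y d}"
    using L by auto
  then have xyE: "x \<in> ?E \<longleftrightarrow> y \<in> ?E"
    unfolding even_vertices_def mem_Collect_eq split[of x] split[of y] using L(3-5) by simp
  define P where "P \<longleftrightarrow> x \<in> ?E"
  have old: "c \<in> ?E \<longleftrightarrow> c \<in> even_vertices C L" if "c \<in> C" for c
  proof -
    have "even (card {d \<in> ?C. L c d}) \<longleftrightarrow> even (card {d \<in> C. L c d})"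
      unfolding split[of c] using L(1)[OF that] by simp
    then show ?thesis
      using that by (simp only: even_vertices_def mem_Collect_eq Un_iff simp_thms)
  qed
  have Esub: "even_vertices C L \<subseteq> C" by (auto simp: even_vertices_def)
  have "?E \<subseteq> ?C" unfolding even_vertices_def by blast
  then have E: "?E = even_vertices C L \<union> (if P then {x, y} else {})"
    using old Esub xyE P_def by (cases P) auto
  have splitE: "card {d \<in> ?E. L c d} = card {d \<in> even_vertices C L. L c d} +
      (if P then of_bool (L c x) + of_bool (L c y) else 0)" for c
  proof (cases P)
    case True
    then have E': "?E = even_vertices C L \<union> {x, y}" using E by simp
    have "even_vertices C L \<inter> {x, y} = {}" using xy Esub by auto
    from card_Un_filter[OF finite_even_vertices[OF fin] _ this, of "L c"]
    have "card {d \<in> ?E. L c d} = card {d \<in> even_vertices C L. L c d} + card {d \<in> {x, y}. L c d}"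
      unfolding E' by simp
    then show ?thesis
      using True by (simp only: card_pair_filter[OF xy(3)] if_True)
  qed (use E in simp)
  show "exponent ?C L x = exponent ?C L y"
  proof (rule exponent_eqI[OF xyE])
    have "{d \<in> even_vertices C L. L x d} = {d \<in> even_vertices C L. L y d}"
      using L Esub by auto
    then show "even (card {d \<in> ?E. L x d}) = even (card {d \<in> ?E. L y d})"
      unfolding splitE[of x] splitE[of y] using L(3-5) by simp
  qed
  show "exponent ?C L c = exponent C L c" if "c \<in> C"
  proof (rule exponent_eqI)
    show "c \<in> ?E \<longleftrightarrow> c \<in> even_vertices C L"
      using that by (rule old)
    show "even (card {d \<in> ?E. L c d}) = even (card {d \<in> even_vertices C L. L c d})"
      unfolding splitE[of c] using L(1)[OF that] by auto
  qed
qed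

section \<open>Interlaced crossings\<close>

text \<open>Symmetric in \<open>a\<close> and \<open>b\<close>, so that the two passages of a
  crossing may be named by strand or by arc without deciding which comes first.\<close>

definition separates :: "real \<Rightarrow> real \<Rightarrow> real \<Rightarrow> bool" where
  "separates a b t \<longleftrightarrow> a < t \<and> t < b \<or> b < t \<and> t < a"

text \<open>Interlacement of chords in the Gauss diagram, stated as a parity of passages because
  this is the form in which it comes out of \<open>index_sum\<close>.\<close>

definition linked :: "diagram \<Rightarrow> complex \<Rightarrow> complex \<Rightarrow> bool" where
  "linked K c d \<longleftrightarrow> odd (card (passages K d \<inter> component K 0 c))"

lemma double_point_passages:
  assumes "x \<in> double_points K"
  obtains a b where "passages K x = {a, b}" "a \<noteq> b"
  using assms by (auto simp: double_points_def card_2_iff)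

lemma passages_eqI:
  assumes "x \<in> double_points K" "a \<in> passages K x" "b \<in> passages K x" "a \<noteq> b"
  shows "passages K x = {a, b}"
  using assms by (auto elim!: double_point_passages)

lemma passages_memD: "t \<in> passages K x \<Longrightarrow> 0 \<le> t \<and> t < 1 \<and> curve K t = x"
  by (simp add: passages_def)

lemma component_0:
  assumes "passages K c = {a, b}"
  shows "component K 0 c = {t. separates a b t}"
  using assms by (auto simp: component_def separates_def min_def max_def)

lemma component_1:
  assumes "passages K c = {a, b}"
  shows "component K (Suc 0) c = {0..<1} - {a, b} - component K 0 c"
proof -
  have "a \<in> passages K c" "b \<in> passages K c"
    using assms by auto
  then have "0 \<le> a" "a < 1" "0 \<le> b" "b < 1"
    by (auto dest: passages_memD)
  moreover have "component K (Suc 0) c = {0..<min a b} \<union> {max a b<..<1}"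
    "component K 0 c = {min a b<..<max a b}"
    unfolding component_def assms by (simp_all add: Let_def)
  moreover have "{0..<m} \<union> {M<..<1} = {0..<1} - {m, M} - {m<..<M}" if "0 \<le> m" "m \<le> M" "M < 1" for m M :: real
    using that by auto
  from this[of "min a b" "max a b"]
  have "{0..<min a b} \<union> {max a b<..<1} = {0..<1} - {min a b, max a b} - {min a b<..<max a b}"
    using \<open>0 \<le> a\<close> \<open>a < 1\<close> \<open>0 \<le> b\<close> \<open>b < 1\<close> by simp
  moreover have "{min a b, max a b} = {a, b}"
    by (auto simp: min_def max_def)
  ultimately show ?thesis
    by simp
qed

lemma component_subset:
  assumes "c \<in> double_points K" "l \<in> {0, 1}"
  shows "component K l c \<subseteq> {0..<1}"
proof -
  obtain a b where ab: "passages K c = {a, b}"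
    using assms(1) by (rule double_point_passages)
  have "0 \<le> a" "a < 1" "0 \<le> b" "b < 1"
    using passages_memD[of a K c] passages_memD[of b K c] ab by auto
  then have "component K 0 c \<subseteq> {0..<1}"
    unfolding component_0[OF ab] separates_def by auto
  moreover have "component K 1 c \<subseteq> {0..<1}"
    using component_1[OF ab] by auto
  ultimately show ?thesis
    using assms(2) by blast
qed

lemma linked_iff:
  assumes "passages K c = {a, b}" "passages K d = {p, q}" "p \<noteq> q"
  shows "linked K c d \<longleftrightarrow> separates a b p \<noteq> separates a b q"
proof -
  have "passages K d \<inter> component K 0 c = {t \<in> {p, q}. separates a b t}"
    using assms component_0[OF assms(1)] by auto
  then show ?thesis
    unfolding linked_def by (simp only: card_pair_filter[OF assms(3)]) auto
qed

lemma not_linked_self: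
  assumes "c \<in> double_points K"
  shows "\<not> linked K c c"
proof -
  obtain a b where "passages K c = {a, b}" "a \<noteq> b"
    using assms by (rule double_point_passages)
  then show ?thesis
    using linked_iff[of K c a b c a b] by (simp add: separates_def)
qed

lemma passages_disjoint: "c \<noteq> d \<Longrightarrow> passages K c \<inter> passages K d = {}"
  by (auto simp: passages_def)

lemma separates_interlaced:
  assumes "a \<noteq> b" "p \<noteq> q" "a \<noteq> p" "a \<noteq> q" "b \<noteq> p" "b \<noteq> q"
  shows "(separates a b p \<noteq> separates a b q) \<longleftrightarrow> (separates p q a \<noteq> separates p q b)"
  using assms unfolding separates_def by linarith

lemma linked_sym:
  assumes "c \<in> double_points K" "d \<in> double_points K"
  shows "linked K c d \<longleftrightarrow> linked K d c"
proof (cases "c = d")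
  case False
  obtain a b p q where "passages K c = {a, b}" "a \<noteq> b" "passages K d = {p, q}" "p \<noteq> q"
    using assms by (meson double_point_passages)
  then show ?thesis
    using linked_iff[of K c a b d p q] linked_iff[of K d p q c a b]
      separates_interlaced[of a b p q] passages_disjoint[OF False, of K] by auto
qed simp

text \<open>For \<open>d\<close> different from \<open>c\<close> the two passages of
  \<open>d\<close> are distributed over the two components, so both counts have the same parity; for
  \<open>d = c\<close> both counts are 0. Hence no index parity depends on the label of the
  component.\<close>

lemma linked_component:
  assumes "c \<in> double_points K" "d \<in> double_points K" "l \<in> {0, 1}"
  shows "odd (card (passages K d \<inter> component K l c)) \<longleftrightarrow> linked K c d"
proof (cases "l = 0")
  case False
  obtain a b p q where ab: "passages K c = {a, b}" "a \<noteq> b" and pq: "passages K d = {p, q}" "p \<noteq> q"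
    using assms by (meson double_point_passages)
  have "p \<in> {0..<1}" "q \<in> {0..<1}"
    using pq passages_memD[of p K d] passages_memD[of q K d] by auto
  then have *: "passages K d \<inter> component K 1 c = {t \<in> {p, q}. t \<notin> {a, b} \<and> \<not> separates a b t}"
    using component_1[OF ab(1)] component_0[OF ab(1)] pq by auto
  have "{p, q} = {a, b} \<or> {p, q} \<inter> {a, b} = {}"
    using passages_disjoint[of c d K] ab pq by (cases "c = d") auto
  then have "((p \<notin> {a, b} \<and> \<not> separates a b p) \<noteq> (q \<notin> {a, b} \<and> \<not> separates a b q))
      \<longleftrightarrow> (separates a b p \<noteq> separates a b q)"
  proof
    assume "{p, q} = {a, b}"
    then have "p \<in> {a, b}" "q \<in> {a, b}" by auto
    then show ?thesis by (auto simp: separates_def)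
  qed auto
  moreover have "linked K c d \<longleftrightarrow> separates a b p \<noteq> separates a b q"
    by (rule linked_iff) fact+
  moreover have "l = 1" using False assms(3) by simp
  moreover have "odd (of_bool P + of_bool Q :: nat) \<longleftrightarrow> P \<noteq> Q" for P Q
    by simp
  ultimately show ?thesis
    by (simp only: * card_pair_filter[OF pq(2)])
qed (simp add: linked_def)


section \<open>The polynomial as a sum over crossings\<close>

definition weight :: "nat \<Rightarrow> nat \<Rightarrow> nat \<Rightarrow> int poly poly" where
  "weight e p q = (var_s ^ e * var_t ^ p - 1) * (var_s ^ e * var_t ^ q - 1)"

lemma weight_commute: "weight e p q = weight e q p"
  unfolding weight_def by (rule mult.commute)

text \<open>The vertex set \<open>X\<close> is a separate parameter: for a singular diagram it has
  to contain the singular crossings as well, since these become vertices of the graph once they are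
  resolved.\<close>

definition crossing_weight :: "diagram \<Rightarrow> complex set \<Rightarrow> complex \<Rightarrow> int poly poly" where
  "crossing_weight K X c =
     weight (exponent X (linked K) c) (bar_parity K 0 c) (bar_parity K 1 c)"

locale knot_diagram =
  fixes K :: diagram
  assumes diagram: "singular_twisted_knot_diagram K"
begin

lemma finite_double_points: "finite (double_points K)"
  using diagram by (simp add: singular_twisted_knot_diagram_def)

lemma classical_subset: "classical_crossings K \<subseteq> double_points K"
  by (auto simp: classical_crossings_def)

lemma finite_classical: "finite (classical_crossings K)"
  using finite_double_points classical_subset finite_subset by blast

lemma classicalE:
  assumes "x \<in> classical_crossings K"
  obtains a b where "mark K x = Classical a" "passages K x = {a, b}" "a \<noteq> b"
proof -
  obtain a where a: "mark K x = Classical a" and x: "x \<in> double_points K"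
    using assms by (auto simp: classical_crossings_def)
  then have "a \<in> passages K x"
    using diagram by (auto simp: singular_twisted_knot_diagram_def)
  moreover obtain p q where pq: "passages K x = {p, q}" "p \<noteq> q"
    using x by (rule double_point_passages)
  ultimately consider "a = p" | "a = q"
    by blast
  then show ?thesis
  proof cases
    case 1
    show ?thesis by (rule that[of a q]) (use a pq 1 in auto)
  next
    case 2
    show ?thesis by (rule that[of a p]) (use a pq 2 in auto)
  qed
qed

lemma crossing_sign_eq:
  assumes "mark K x = Classical a" "passages K x = {a, b}" "a \<noteq> b"
  shows "crossing_sign K x = (if wedge (velocity K a) (velocity K b) > 0 then 1 else -1)"
proof -
  have "(THE t. t \<in> passages K x \<and> t \<noteq> a) = b"
    using assms by auto
  then show ?thesis
    using assms by (simp add: crossing_sign_def)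
qed

lemma odd_crossing_sign:
  assumes "x \<in> classical_crossings K"
  shows "odd (crossing_sign K x)"
proof -
  obtain a b where "mark K x = Classical a" "passages K x = {a, b}" "a \<noteq> b"
    using assms by (rule classicalE)
  then show ?thesis
    using crossing_sign_eq[of x a b] by simp
qed

text \<open>Each summand is odd, so the sum has the parity of the number of times counted. Grouped
  by crossing, a self-crossing of the component contributes two times and a crossing off the
  component none, which leaves the linked ones. The set \<open>X\<close> varies because
  \<open>ind\<close> takes all classical crossings and \<open>zind\<close> only the zero
  crossings.\<close>

lemma even_index_sum_iff:
  assumes X: "X \<subseteq> classical_crossings K" and c: "c \<in> double_points K" and l: "l \<in> {0, 1}"
  shows "even (index_sum K X l c) \<longleftrightarrow> even (card {d \<in> X. linked K c d})"
proof -
  have finX: "finite X"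
    using X finite_classical finite_subset by blast
  have finp: "finite (passages K d)" for d
    using diagram by (auto simp: singular_twisted_knot_diagram_def)
  let ?S = "{t \<in> component K l c. curve K t \<in> X}"
  have "component K l c \<subseteq> {0..<1}"
    using c l by (rule component_subset)
  then have S: "?S = (\<Union>d\<in>X. passages K d \<inter> component K l c)"
    unfolding passages_def by blast
  have finS: "finite ?S"
    unfolding S using finX finp by auto
  have "even (index_sum K X l c) \<longleftrightarrow> even (card ?S)"
  proof -
    have "{t \<in> ?S. odd ((-1) ^ over_passage K t * crossing_sign K (curve K t))} = ?S"
      using odd_crossing_sign X by auto
    then show ?thesis
      unfolding index_sum_def even_sum_iff[OF finS] by (simp only:)
  qed
  also have "card ?S = (\<Sum>d\<in>X. card (passages K d \<inter> component K l c))"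
    unfolding S using finX finp by (intro card_UN_disjoint) (auto simp: passages_def)
  also have "even \<dots> \<longleftrightarrow> even (card {d \<in> X. odd (card (passages K d \<inter> component K l c))})"
    by (rule even_sum_iff[OF finX])
  also have "{d \<in> X. odd (card (passages K d \<inter> component K l c))} = {d \<in> X. linked K c d}"
    using linked_component[OF c _ l] X classical_subset by auto
  finally show ?thesis .
qed

lemma zero_crossings_eq: "zero_crossings K = even_vertices (classical_crossings K) (linked K)"
  using even_index_sum_iff[OF order_refl] classical_subset
  unfolding zero_crossings_def even_vertices_def ind_def by auto

lemma zero_parity_eq:
  assumes "c \<in> zero_crossings K"
  shows "zero_parity K c = exponent (classical_crossings K) (linked K) c"
proof -
  have "zero_crossings K \<subseteq> classical_crossings K" "c \<in> double_points K"
    using assms classical_subset by (auto simp: zero_crossings_def)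
  from even_index_sum_iff[OF this, of 0]
  have "even (zind K 0 c) \<longleftrightarrow> even (card {d \<in> zero_crossings K. linked K c d})"
    by (simp add: zind_def)
  then show ?thesis
    using assms unfolding zero_parity_def exponent_def zero_crossings_eq
    by (simp add: mod2_eq_if)
qed

lemma Qz_eq:
  "Qz K = (\<Sum>c \<in> classical_crossings K.
     of_int (crossing_sign K c) * crossing_weight K (classical_crossings K) c)"
proof -
  let ?C = "classical_crossings K" and ?Z = "zero_crossings K"
  let ?g = "\<lambda>c. of_int (crossing_sign K c) * crossing_weight K ?C c"
  have Z: "?Z \<subseteq> ?C" by (auto simp: zero_crossings_def)
  have "of_int (crossing_sign K c) *
        (var_s ^ zero_parity K c * var_t ^ bar_parity K 0 c - 1) *
        (var_s ^ zero_parity K c * var_t ^ bar_parity K 1 c - 1) = ?g c" if "c \<in> ?Z" for c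
    using zero_parity_eq[OF that] by (simp add: crossing_weight_def weight_def mult.assoc)
  moreover have "of_int (crossing_sign K c) *
        (var_s * var_t ^ bar_parity K 0 c - 1) *
        (var_s * var_t ^ bar_parity K 1 c - 1) = ?g c" if "c \<in> ?C - ?Z" for c
  proof -
    have "exponent ?C (linked K) c = 1"
      using that zero_crossings_eq by (simp add: exponent_def)
    then show ?thesis
      by (simp add: crossing_weight_def weight_def mult.assoc)
  qed
  ultimately have "Qz K = sum ?g ?Z + sum ?g (?C - ?Z)"
    unfolding Qz_def by (intro arg_cong2[where f = "(+)"] sum.cong) auto
  also have "\<dots> = sum ?g ?C"
    using sum.subset_diff[OF Z finite_classical, of ?g] by (simp add: add.commute)
  finally show ?thesis .
qed

text \<open>No bar sits at \<open>c\<close>, so each bar lies on exactly one component. In the local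
  moves it therefore suffices to control component 0 and the parity of all bars.\<close>

lemma bar_parity_1:
  assumes "c \<in> double_points K"
  shows "bar_parity K 1 c = (card (bars K) + bar_parity K 0 c) mod 2"
proof -
  obtain a b where ab: "passages K c = {a, b}"
    using assms by (rule double_point_passages)
  have fin: "finite (bars K)" and b01: "bars K \<subseteq> {0..<1}"
    and "\<forall>t \<in> bars K. curve K t \<notin> double_points K"
    using diagram by (auto simp: singular_twisted_knot_diagram_def)
  then have "a \<notin> bars K" "b \<notin> bars K"
    using passages_memD[of a K c] passages_memD[of b K c] ab assms by auto
  then have 1: "bars K \<inter> component K 1 c = bars K - component K 0 c"
    using component_1[OF ab] b01 by auto
  have 2: "card (bars K) = card (bars K \<inter> component K 0 c) + card (bars K - component K 0 c)"
    using fin by (metis card_Int_Diff)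
  have "n mod 2 = (m + n + m mod 2) mod 2" for m n :: nat
    by (simp add: mod2_eq_if)
  then show ?thesis
    unfolding bar_parity_def 1 2 .
qed

end

lemma twisted_imp_knot_diagram: "twisted_knot_diagram K \<Longrightarrow> knot_diagram K"
  by (simp add: twisted_knot_diagram_def knot_diagram_def)

text \<open>The bar parities are compared as multisets because a new base point may exchange
  components 0 and 1, and \<open>weight\<close> is symmetric in them. In the applications
  \<open>T\<close> is nonempty only for the third Reidemeister move.\<close>

lemma Qz_transfer:
  assumes K: "twisted_knot_diagram K" and K': "twisted_knot_diagram K'"
    and bij: "bij_betw F (classical_crossings K) (classical_crossings K')"
    and T: "T \<subseteq> classical_crossings K" "T = {} \<or> card T = 3"
    and ev: "\<And>c. c \<in> classical_crossings K - T \<Longrightarrow> even (card {t \<in> T. linked K c t})"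
    and L: "\<And>c d. c \<in> classical_crossings K \<Longrightarrow> d \<in> classical_crossings K \<Longrightarrow>
      linked K' (F c) (F d) \<longleftrightarrow> (linked K c d \<noteq> (c \<in> T \<and> d \<in> T \<and> c \<noteq> d))"
    and sign: "\<And>c. c \<in> classical_crossings K \<Longrightarrow> crossing_sign K' (F c) = crossing_sign K c"
    and bars: "\<And>c. c \<in> classical_crossings K \<Longrightarrow>
      {#bar_parity K' 0 (F c), bar_parity K' 1 (F c)#} = {#bar_parity K 0 c, bar_parity K 1 c#}"
  shows "Qz K = Qz K'"
proof -
  interpret K: knot_diagram K using K by (rule twisted_imp_knot_diagram)
  interpret K': knot_diagram K' using K' by (rule twisted_imp_knot_diagram)
  let ?C = "classical_crossings K" and ?C' = "classical_crossings K'"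
  have dp: "c \<in> double_points K" if "c \<in> ?C" for c
    using that K.classical_subset by auto
  have e: "exponent ?C' (linked K') (F c) = exponent ?C (linked K) c" if "c \<in> ?C" for c
    by (rule exponent_transfer[OF K.finite_classical bij T])
      (use that ev L dp linked_sym not_linked_self in auto)
  have "weight e (bar_parity K' 0 (F c)) (bar_parity K' 1 (F c)) =
      weight e (bar_parity K 0 c) (bar_parity K 1 c)" if "c \<in> ?C" for e c
    using bars[OF that] weight_commute by (auto simp: add_eq_conv_ex)
  then have "crossing_weight K' ?C' (F c) = crossing_weight K ?C c" if "c \<in> ?C" for c
    using e that by (simp add: crossing_weight_def)
  then have "(\<Sum>c\<in>?C. of_int (crossing_sign K c) * crossing_weight K ?C c) =
      (\<Sum>c\<in>?C. of_int (crossing_sign K' (F c)) * crossing_weight K' ?C' (F c))"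
    using sign by (intro sum.cong) auto
  also have "\<dots> = (\<Sum>c\<in>?C'. of_int (crossing_sign K' c) * crossing_weight K' ?C' c)"
    using bij by (rule sum.reindex_bij_betw)
  finally show ?thesis
    unfolding K.Qz_eq K'.Qz_eq .
qed

section \<open>Local moves\<close>

lemma separates_arcs:
  assumes "A = {a..b}" "A' = {a'..b'}" "p \<in> A" "p' \<in> A" "q \<in> A'" "q' \<in> A'" "t \<notin> A" "t \<notin> A'"
  shows "separates p q t \<longleftrightarrow> separates p' q' t"
  using assms by (auto simp: separates_def)

lemma separates_same_arc:
  assumes "A = {a..b}" "s \<in> A" "t \<in> A" "p \<notin> A" "q \<notin> A"
  shows "separates p q s \<longleftrightarrow> separates p q t"
  using assms by (auto simp: separates_def)

text \<open>The arcs are disjoint intervals, so the chord from \<open>A\<close> to \<open>B\<close>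
  and the chord from \<open>A\<close> to \<open>D\<close> change their relative position only by the
  order of their ends on \<open>A\<close>. Exchanging two neighbouring chord ends toggles whether
  the chords cross.\<close>

lemma separates_exchange:
  assumes A: "A = {a..b}" "B = {c..d}" "D = {e..f}"
    and disj: "A \<inter> B = {}" "A \<inter> D = {}" "B \<inter> D = {}"
    and "p \<in> A" "q \<in> A" "p' \<in> A" "q' \<in> A" "y \<in> B" "y' \<in> B" "z \<in> D" "z' \<in> D"
    and pq: "p \<noteq> q" "p' \<noteq> q'" "p < q \<longleftrightarrow> q' < p'"
  shows "(separates p' y' q' \<noteq> separates p' y' z') \<longleftrightarrow> \<not> (separates p y q \<noteq> separates p y z)"
proof -
  have "b < c \<or> d < a" "b < e \<or> f < a" "d < e \<or> f < c"
    using assms by auto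
  moreover have "a \<le> p" "p \<le> b" "a \<le> q" "q \<le> b" "a \<le> p'" "p' \<le> b" "a \<le> q'" "q' \<le> b"
    "c \<le> y" "y \<le> d" "c \<le> y'" "y' \<le> d" "e \<le> z" "z \<le> f" "e \<le> z'" "z' \<le> f"
    using assms by auto
  moreover have "p < q \<and> q' < p' \<or> q < p \<and> p' < q'"
    using pq by auto
  ultimately show ?thesis
    unfolding separates_def by (elim disjE conjE) simp_all
qed

lemma velocity_cong:
  assumes per: "\<And>t. curve K (t + 1) = curve K t" "\<And>t. curve K' (t + 1) = curve K' t"
    and U: "closed U" "U \<subseteq> {0<..<1}"
    and eq: "\<And>t. t \<in> {0..<1} - U \<Longrightarrow> curve K' t = curve K t"
    and t: "t \<in> {0..<1} - U"
  shows "velocity K' t = velocity K t"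
proof -
  \<comment> \<open>A neighbourhood of the base point 0 contains negative times. Periodicity carries
    these to times just before 1, hence the second set that is removed.\<close>
  let ?V = "{-1<..<1} - U - (\<lambda>s. s + 1) -` U"
  have "closed ((\<lambda>s. s + 1) -` U)"
    using U(1) by (intro continuous_closed_vimage) auto
  then have "open ?V"
    using U(1) by (intro open_Diff) auto
  moreover have "t \<in> ?V"
    using t U(2) by auto
  moreover have "curve K' s = curve K s" if "s \<in> ?V" for s
  proof (cases "s \<ge> 0")
    case False
    then have "s + 1 \<in> {0..<1} - U" using that by auto
    from eq[OF this] show ?thesis by (simp add: per)
  qed (use that eq in auto)
  ultimately have "eventually (\<lambda>s. s \<in> UNIV \<longrightarrow> curve K' s = curve K s) (nhds t)"
    by (auto simp: eventually_nhds)
  then show ?thesis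
    unfolding velocity_def by (rule vector_derivative_cong_eq) auto
qed

text \<open>Each arc lies wholly inside or wholly outside \<open>S\<close> and carries an even
  number of elements of \<open>b\<close>, so discarding the arcs keeps the parity. Two diagrams with
  the same bars off the arcs become comparable in this way, even when the arcs themselves carry
  bars.\<close>

lemma even_card_iff_outside:
  assumes fin: "finite \<A>" "finite b"
    and disj: "\<And>A A'. A \<in> \<A> \<Longrightarrow> A' \<in> \<A> \<Longrightarrow> A \<noteq> A' \<Longrightarrow> A \<inter> A' = {}"
    and S: "\<And>A. A \<in> \<A> \<Longrightarrow> A \<subseteq> S \<or> A \<inter> S = {}"
    and even: "\<And>A. A \<in> \<A> \<Longrightarrow> even (card (b \<inter> A))"
  shows "even (card (b \<inter> S)) \<longleftrightarrow> even (card ((b - \<Union>\<A>) \<inter> S))"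
proof -
  let ?W = "{A \<in> \<A>. A \<subseteq> S}"
  have "b \<inter> S = ((b - \<Union>\<A>) \<inter> S) \<union> (\<Union>A\<in>?W. b \<inter> A)"
    using S by blast
  moreover have "card \<dots> = card ((b - \<Union>\<A>) \<inter> S) + card (\<Union>A\<in>?W. b \<inter> A)"
    using fin by (intro card_Un_disjoint) auto
  moreover have "card (\<Union>A\<in>?W. b \<inter> A) = (\<Sum>A\<in>?W. card (b \<inter> A))"
    using fin disj by (intro card_UN_disjoint) auto
  moreover have "even (\<Sum>A\<in>?W. card (b \<inter> A))"
    using even by (intro dvd_sum) auto
  ultimately show ?thesis
    by presburger
qed

section \<open>Two diagrams that agree outside a disc\<close>

locale local_move = K: knot_diagram K + K': knot_diagram K' for K K' +
  fixes B :: "complex set" and As :: "real set list"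
  assumes change: "local_change B As K K'"
begin

abbreviation U :: "real set" where "U \<equiv> \<Union> (set As)"

lemmas change_parts = change[unfolded local_change_def, THEN conjunct2]

lemma nth_arcs_disjoint:
  "i < length As \<Longrightarrow> j < length As \<Longrightarrow> i \<noteq> j \<Longrightarrow> As ! i \<inter> As ! j = {}"
  using change_parts[THEN conjunct1] by blast

lemma arcs_disjoint:
  assumes "A \<in> set As" "A' \<in> set As" "A \<noteq> A'"
  shows "A \<inter> A' = {}"
proof -
  obtain i j where "i < length As" "j < length As" "A = As ! i" "A' = As ! j"
    using assms by (metis in_set_conv_nth)
  then show ?thesis
    using nth_arcs_disjoint[of i j] assms(3) by blast
qed

lemma arcE:
  assumes "A \<in> set As"
  obtains a b where "0 < a" "b < 1" "A = {a..b}"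
proof -
  have "\<exists>a b. 0 < a \<and> a < b \<and> b < 1 \<and> A = {a..b} \<and>
      (\<forall>L \<in> {K, K'}. curve L a \<in> frontier B \<and> curve L b \<in> frontier B \<and>
         curve L ` {a<..<b} \<subseteq> interior B)"
    using change_parts[THEN conjunct2, THEN conjunct1] assms by (rule bspec)
  then obtain a b where "0 < a" "b < 1" "A = {a..b}"
    by (elim exE conjE)
  then show ?thesis by (rule that)
qed

lemma U_subset: "U \<subseteq> {0<..<1}"
  by (auto elim!: arcE)

lemma closed_U: "closed U"
  by (intro closed_Union) (auto elim!: arcE)

lemma curve_in_B:
  assumes "t \<in> {0..<1}"
  shows "curve K t \<in> B \<longleftrightarrow> t \<in> U" "curve K' t \<in> B \<longleftrightarrow> t \<in> U"
proof -
  have "\<forall>L\<in>{K, K'}. {t \<in> {0..<1}. curve L t \<in> B} = U"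
    by (rule change_parts[THEN conjunct2, THEN conjunct2, THEN conjunct1])
  then have "{t \<in> {0..<1}. curve K t \<in> B} = U" "{t \<in> {0..<1}. curve K' t \<in> B} = U"
    by simp_all
  then show "curve K t \<in> B \<longleftrightarrow> t \<in> U" "curve K' t \<in> B \<longleftrightarrow> t \<in> U"
    using assms by blast+
qed

lemma curve_eq: "t \<in> {0..<1} - U \<Longrightarrow> curve K' t = curve K t"
  using change_parts[THEN conjunct2, THEN conjunct2, THEN conjunct2, THEN conjunct1] by (rule bspec)

lemma mark_eq: "x \<in> double_points K \<Longrightarrow> x \<notin> B \<Longrightarrow> mark K' x = mark K x"
  using change_parts[THEN conjunct2, THEN conjunct2, THEN conjunct2, THEN conjunct2, THEN conjunct1]
  by simp

lemma bars_eq: "bars K' - U = bars K - U"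
  by (rule change_parts[THEN conjunct2, THEN conjunct2, THEN conjunct2, THEN conjunct2, THEN conjunct2])

lemma arc_range:
  assumes "A \<in> set As" "t \<in> A"
  shows "t \<in> {0..<1}"
proof -
  have "t \<in> U" using assms by blast
  then have "t \<in> {0<..<1}" using U_subset by (rule rev_subsetD)
  then show ?thesis by simp
qed

lemma passage_arc: "A \<in> set As \<Longrightarrow> t \<in> A \<Longrightarrow> t \<in> passages L (curve L t)"
  using arc_range by (simp add: passages_def)

lemma passages_eq:
  assumes "x \<notin> B"
  shows "passages K' x = passages K x"
proof -
  have "curve K' t = x \<longleftrightarrow> curve K t = x" if "t \<in> {0..<1}" for t
  proof (cases "t \<in> U")
    case True
    then show ?thesis using curve_in_B[OF that] assms by auto
  next
    case False
    then show ?thesis using curve_eq[of t] that by simp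
  qed
  then show ?thesis
    unfolding passages_def by blast
qed

lemma double_points_eq: "x \<notin> B \<Longrightarrow> x \<in> double_points K' \<longleftrightarrow> x \<in> double_points K"
  by (simp add: double_points_def passages_eq)

lemma classical_eq: "x \<notin> B \<Longrightarrow> x \<in> classical_crossings K' \<longleftrightarrow> x \<in> classical_crossings K"
  using mark_eq double_points_eq by (auto simp: classical_crossings_def)

lemma component_eq: "x \<notin> B \<Longrightarrow> component K' l x = component K l x"
  by (simp add: component_def passages_eq)

lemma linked_eq: "x \<notin> B \<Longrightarrow> y \<notin> B \<Longrightarrow> linked K' x y \<longleftrightarrow> linked K x y"
  by (simp add: linked_def component_eq passages_eq)

lemma passage_outside:
  assumes "x \<notin> B" "t \<in> passages K x"
  shows "t \<in> {0..<1} - U"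
  using assms curve_in_B by (auto simp: passages_def)

lemma velocity_eq:
  assumes "t \<in> {0..<1} - U"
  shows "velocity K' t = velocity K t"
  by (rule velocity_cong[OF _ _ closed_U U_subset _ assms])
    (use K.diagram K'.diagram curve_eq in \<open>auto simp: singular_twisted_knot_diagram_def\<close>)

lemma sign_eq:
  assumes "x \<in> classical_crossings K" "x \<notin> B"
  shows "crossing_sign K' x = crossing_sign K x"
proof -
  obtain a b where x: "mark K x = Classical a" "passages K x = {a, b}" "a \<noteq> b"
    using assms(1) by (rule K.classicalE)
  then have "velocity K' a = velocity K a" "velocity K' b = velocity K b"
    using passage_outside[OF assms(2)] velocity_eq by blast+
  moreover have "mark K' x = Classical a"
    using x mark_eq assms K.classical_subset by auto
  moreover have "passages K' x = {a, b}"
    using x passages_eq assms by auto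
  ultimately show ?thesis
    using K.crossing_sign_eq[OF x] K'.crossing_sign_eq[of x a b] x(3) by simp
qed

lemma even_bars:
  assumes "\<And>A. A \<in> set As \<Longrightarrow> even (card (bars K \<inter> A)) \<and> even (card (bars K' \<inter> A))"
    and "\<And>A. A \<in> set As \<Longrightarrow> A \<subseteq> S \<or> A \<inter> S = {}"
  shows "even (card (bars K' \<inter> S)) \<longleftrightarrow> even (card (bars K \<inter> S))"
proof -
  have "finite (bars K)" "finite (bars K')"
    using K.diagram K'.diagram by (auto simp: singular_twisted_knot_diagram_def)
  then show ?thesis
    using even_card_iff_outside[of "set As" "bars K" S] even_card_iff_outside[of "set As" "bars K'" S]
      arcs_disjoint assms bars_eq by simp
qed

text \<open>The passages of a crossing outside the disc avoid the arcs, so the smoothing there cuts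
  no arc in two.\<close>

lemma arc_component:
  assumes "x \<in> double_points K" "x \<notin> B" "A \<in> set As"
  shows "A \<subseteq> component K 0 x \<or> A \<inter> component K 0 x = {}"
proof -
  obtain p q where pq: "passages K x = {p, q}" "p \<noteq> q"
    using assms(1) by (rule double_point_passages)
  then have "p \<notin> A" "q \<notin> A"
    using passage_outside[OF assms(2)] assms(3) by blast+
  moreover obtain a b where "A = {a..b}"
    using assms(3) by (rule arcE)
  ultimately show ?thesis
    using separates_same_arc[of A a b _ _ p q] component_0[OF pq(1)] by blast
qed

lemma bar_parity_outside:
  assumes "\<And>A. A \<in> set As \<Longrightarrow> even (card (bars K \<inter> A)) \<and> even (card (bars K' \<inter> A))"
    and "x \<in> double_points K" "x \<notin> B"
  shows "bar_parity K' 0 x = bar_parity K 0 x"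
  using even_bars[OF assms(1) arc_component[OF assms(2,3)]]
  unfolding bar_parity_def component_eq[OF assms(3)] by (auto simp: mod2_eq_if)

lemma bar_parity_1_eq:
  assumes "\<And>A. A \<in> set As \<Longrightarrow> even (card (bars K \<inter> A)) \<and> even (card (bars K' \<inter> A))"
    and "x \<in> double_points K" "x' \<in> double_points K'" "bar_parity K' 0 x' = bar_parity K 0 x"
  shows "bar_parity K' 1 x' = bar_parity K 1 x"
proof -
  \<comment> \<open>With \<open>S = UNIV\<close> every arc lies inside, so this compares the total
    numbers of bars.\<close>
  have "even (card (bars K')) \<longleftrightarrow> even (card (bars K))"
    using even_bars[OF assms(1), of UNIV] by auto
  then show ?thesis
    unfolding K.bar_parity_1[OF assms(2)] K'.bar_parity_1[OF assms(3)] assms(4) by (simp add: mod2_eq_if)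
qed

text \<open>A relation between sets of times rather than crossings: it compares a crossing of
  \<open>K\<close> with its counterpart in \<open>K'\<close>, and also the two new crossings of a
  second Reidemeister move within \<open>K'\<close>.\<close>

definition close :: "real set \<Rightarrow> real set \<Rightarrow> bool" where
  "close P P' \<longleftrightarrow> (\<exists>p q p' q' A A'. P = {p, q} \<and> p \<noteq> q \<and> P' = {p', q'} \<and> p' \<noteq> q' \<and>
     A \<in> set As \<and> A' \<in> set As \<and> p \<in> A \<and> p' \<in> A \<and> q \<in> A' \<and> q' \<in> A')"

lemma closeI:
  assumes "P = {p, q}" "P' = {p', q'}" "A \<in> set As" "A' \<in> set As" "A \<noteq> A'"
    "p \<in> A" "p' \<in> A" "q \<in> A'" "q' \<in> A'"
  shows "close P P'"
proof -
  have "p \<noteq> q" "p' \<noteq> q'" using arcs_disjoint[of A A'] assms by auto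
  then show ?thesis unfolding close_def using assms by blast
qed

lemma linked_close:
  assumes "close (passages L c) (passages L' c')" "passages L d = passages L' d"
    "d \<in> double_points L" "passages L d \<inter> U = {}"
  shows "linked L c d \<longleftrightarrow> linked L' c' d"
proof -
  obtain p q p' q' A A' where *: "passages L c = {p, q}" "passages L' c' = {p', q'}"
    and A: "A \<in> set As" "A' \<in> set As" "p \<in> A" "p' \<in> A" "q \<in> A'" "q' \<in> A'"
    using assms(1) unfolding close_def by blast
  obtain r s where rs: "passages L d = {r, s}" "r \<noteq> s"
    using assms(3) by (rule double_point_passages)
  have "separates p q t \<longleftrightarrow> separates p' q' t" if "t \<in> {r, s}" for t
  proof -
    have "t \<notin> A" "t \<notin> A'" using that assms(4) rs A by auto
    moreover obtain a b a' b' where "A = {a..b}" "A' = {a'..b'}"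
      using A(1,2) by (metis arcE)
    ultimately show ?thesis
      using separates_arcs[of A a b A' a' b'] A by blast
  qed
  then show ?thesis
    using linked_iff[OF *(1) rs] linked_iff[OF *(2) rs[unfolded assms(2)]] by simp
qed

lemma bar_parity_close:
  assumes "close (passages L c) (passages L' c')" "bars L = bars L'" "bars L \<inter> U = {}"
  shows "bar_parity L 0 c = bar_parity L' 0 c'"
proof -
  obtain p q p' q' A A' where *: "passages L c = {p, q}" "passages L' c' = {p', q'}"
    and A: "A \<in> set As" "A' \<in> set As" "p \<in> A" "p' \<in> A" "q \<in> A'" "q' \<in> A'"
    using assms(1) unfolding close_def by blast
  have "separates p q t \<longleftrightarrow> separates p' q' t" if "t \<in> bars L" for t
  proof -
    have "t \<notin> A" "t \<notin> A'" using that assms(3) A by auto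
    moreover obtain a b a' b' where "A = {a..b}" "A' = {a'..b'}"
      using A(1,2) by (metis arcE)
    ultimately show ?thesis
      using separates_arcs[of A a b A' a' b'] A by blast
  qed
  then have "bars L \<inter> component L 0 c = bars L' \<inter> component L' 0 c'"
    using assms(2) component_0[OF *(1)] component_0[OF *(2)] by auto
  then show ?thesis
    by (simp add: bar_parity_def)
qed

lemma no_bars_eq:
  assumes "no_bars K As" "no_bars K' As"
  shows "bars K' = bars K"
  using bars_eq assms unfolding no_bars_def by blast

lemma no_bars_even:
  assumes "no_bars K As" "no_bars K' As" "A \<in> set As"
  shows "even (card (bars K \<inter> A)) \<and> even (card (bars K' \<inter> A))"
proof -
  have "bars K \<inter> A = {}" "bars K' \<inter> A = {}"
    using assms unfolding no_bars_def by blast+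
  then show ?thesis by simp
qed

text \<open>Crossings outside the disc stay as they are, and \<open>close\<close> settles the links
  between inside and outside, so only links, signs and bar parities of the crossings inside remain
  to be compared. Even numbers of bars on the arcs preserve the bar parities of the outer crossings
  and the total parity.\<close>

lemma Qz_local:
  assumes tw: "twisted_knot_diagram K" "twisted_knot_diagram K'"
    and f: "bij_betw f (classical_crossings K \<inter> B) (classical_crossings K' \<inter> B)"
    and T: "T \<subseteq> classical_crossings K \<inter> B" "T = {} \<or> card T = 3"
    and ev: "\<And>c. c \<in> classical_crossings K - T \<Longrightarrow> even (card {t \<in> T. linked K c t})"
    and close: "\<And>c. c \<in> classical_crossings K \<inter> B \<Longrightarrow> close (passages K c) (passages K' (f c))"
    and L: "\<And>c d. c \<in> classical_crossings K \<inter> B \<Longrightarrow> d \<in> classical_crossings K \<inter> B \<Longrightarrow>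
      linked K' (f c) (f d) \<longleftrightarrow> (linked K c d \<noteq> (c \<in> T \<and> d \<in> T \<and> c \<noteq> d))"
    and sign: "\<And>c. c \<in> classical_crossings K \<inter> B \<Longrightarrow> crossing_sign K' (f c) = crossing_sign K c"
    and even: "\<And>A. A \<in> set As \<Longrightarrow> even (card (bars K \<inter> A)) \<and> even (card (bars K' \<inter> A))"
    and bars: "\<And>c. c \<in> classical_crossings K \<inter> B \<Longrightarrow> bar_parity K' 0 (f c) = bar_parity K 0 c"
  shows "Qz K = Qz K'"
proof -
  let ?C = "classical_crossings K" and ?C' = "classical_crossings K'"
  define F where "F c = (if c \<in> B then f c else c)" for c
  have fB: "f c \<in> ?C' \<inter> B" if "c \<in> ?C \<inter> B" for c
    using f that by (auto simp: bij_betw_def)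
  have "bij_betw F (?C \<inter> B) (?C' \<inter> B)"
    using f by (rule bij_betw_cong[THEN iffD1, rotated]) (simp add: F_def)
  moreover have "bij_betw F (?C - B) (?C' - B)"
    unfolding bij_betw_def inj_on_def using classical_eq by (force simp: F_def image_iff)
  ultimately have "bij_betw F ((?C \<inter> B) \<union> (?C - B)) ((?C' \<inter> B) \<union> (?C' - B))"
    by (rule bij_betw_combine) auto
  moreover have "(?C \<inter> B) \<union> (?C - B) = ?C" "(?C' \<inter> B) \<union> (?C' - B) = ?C'"
    by auto
  ultimately have bij: "bij_betw F ?C ?C'"
    by simp
  have dp: "c \<in> double_points K" if "c \<in> ?C" for c
    using that K.classical_subset by auto
  have dpF: "F c \<in> double_points K'" if "c \<in> ?C" for c
    using that bij K'.classical_subset by (auto simp: bij_betw_def)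
  have mixed: "linked K' (f c) d \<longleftrightarrow> linked K c d"
    if "c \<in> ?C \<inter> B" "d \<in> ?C - B" for c d
    using linked_close[OF close[OF that(1)], of d] that dp passages_eq passage_outside by blast
  show ?thesis
  proof (rule Qz_transfer[OF tw bij _ T(2) ev])
    show "T \<subseteq> ?C" using T by auto
    fix c assume c: "c \<in> ?C"
    show "crossing_sign K' (F c) = crossing_sign K c"
      using c sign sign_eq by (simp add: F_def)
    have "bar_parity K' 0 (F c) = bar_parity K 0 c"
      using c bars bar_parity_outside[OF even dp[OF c]] by (simp add: F_def)
    then show "{#bar_parity K' 0 (F c), bar_parity K' 1 (F c)#} = {#bar_parity K 0 c, bar_parity K 1 c#}"
      using bar_parity_1_eq[OF even dp[OF c] dpF[OF c]] by simp
    fix d assume d: "d \<in> ?C"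
    consider "c \<in> B" "d \<in> B" | "c \<in> B" "d \<notin> B" | "c \<notin> B" "d \<in> B" | "c \<notin> B" "d \<notin> B"
      by blast
    then show "linked K' (F c) (F d) \<longleftrightarrow> (linked K c d \<noteq> (c \<in> T \<and> d \<in> T \<and> c \<noteq> d))"
    proof cases
      case 3
      then have "linked K' (f d) c \<longleftrightarrow> linked K d c"
        using mixed[of d c] c d by auto
      moreover have "linked K' (f d) c \<longleftrightarrow> linked K' c (f d)"
        using linked_sym[OF dpF[OF d] dpF[OF c]] 3 by (simp add: F_def)
      moreover have "linked K d c \<longleftrightarrow> linked K c d"
        using linked_sym dp c d by blast
      ultimately show ?thesis
        using 3 T by (auto simp: F_def)
    qed (use c d L mixed linked_eq T in \<open>auto simp: F_def\<close>)
  qed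
qed

lemma Qz_local_none:
  assumes "twisted_knot_diagram K" "twisted_knot_diagram K'" "no_bars K As" "no_bars K' As"
    and none: "classical_crossings K \<inter> B = {}" "classical_crossings K' \<inter> B = {}"
  shows "Qz K = Qz K'"
  by (rule Qz_local[where f = id and T = "{}"])
    (use assms no_bars_even in \<open>auto simp: bij_betw_def\<close>)

lemma Qz_local_single:
  assumes "twisted_knot_diagram K" "twisted_knot_diagram K'"
    and x: "classical_crossings K \<inter> B = {x}" "classical_crossings K' \<inter> B = {x'}"
    and "close (passages K x) (passages K' x')" "crossing_sign K' x' = crossing_sign K x"
    and "\<And>A. A \<in> set As \<Longrightarrow> even (card (bars K \<inter> A)) \<and> even (card (bars K' \<inter> A))"
    and "bar_parity K' 0 x' = bar_parity K 0 x"
  shows "Qz K = Qz K'"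
proof (rule Qz_local[where f = "\<lambda>_. x'" and T = "{}"])
  have "x \<in> double_points K" "x' \<in> double_points K'"
    using x K.classical_subset K'.classical_subset by blast+
  then show "linked K' x' x' \<longleftrightarrow> (linked K c d \<noteq> (c \<in> {} \<and> d \<in> {} \<and> c \<noteq> d))"
    if "c \<in> classical_crossings K \<inter> B" "d \<in> classical_crossings K \<inter> B" for c d
    using that not_linked_self unfolding x by auto
qed (use assms in \<open>auto simp: bij_betw_def\<close>)

end

section \<open>The moves that change the curve inside a disc\<close>

lemma classical_crossings_Int:
  "classical_crossings K \<inter> B = {x \<in> double_points K \<inter> B. \<exists>u. mark K x = Classical u}"
  by (auto simp: classical_crossings_def)

lemma triangleD:
  assumes "triangle B As s K"
  shows "length As = 3" "no_bars K As"
    and "\<forall>i < 3. \<forall>j < 3. i \<noteq> j \<longrightarrow> s i j \<in> As ! i \<and> curve K (s i j) = curve K (s j i)"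
    and "double_points K \<inter> B = {curve K (s 0 1), curve K (s 0 2), curve K (s 1 2)}"
proof -
  note parts = assms[unfolded triangle_def]
  show "length As = 3" by (rule parts[THEN conjunct1])
  show "no_bars K As" by (rule parts[THEN conjunct2, THEN conjunct1])
  show "\<forall>i < 3. \<forall>j < 3. i \<noteq> j \<longrightarrow> s i j \<in> As ! i \<and> curve K (s i j) = curve K (s j i)"
    by (rule parts[THEN conjunct2, THEN conjunct2, THEN conjunct1])
  show "double_points K \<inter> B = {curve K (s 0 1), curve K (s 0 2), curve K (s 1 2)}"
    by (rule parts[THEN conjunct2, THEN conjunct2, THEN conjunct2])
qed

lemma triangle_moveD:
  assumes "triangle_move B As s s' K K'"
  shows "triangle B As s K" "triangle B As s' K'"
    and "\<forall>i < 3. \<forall>j < 3. \<forall>k < 3. i \<noteq> j \<and> i \<noteq> k \<and> j \<noteq> k \<longrightarrow>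
      (s i j < s i k \<longleftrightarrow> s' i k < s' i j)"
proof -
  note parts = assms[unfolded triangle_move_def, THEN conjunct2]
  show "triangle B As s K" by (rule parts[THEN conjunct1])
  show "triangle B As s' K'" by (rule parts[THEN conjunct2, THEN conjunct1])
  show "\<forall>i < 3. \<forall>j < 3. \<forall>k < 3. i \<noteq> j \<and> i \<noteq> k \<and> j \<noteq> k \<longrightarrow>
      (s i j < s i k \<longleftrightarrow> s' i k < s' i j)"
    by (rule parts[THEN conjunct2, THEN conjunct2])
qed

context local_move
begin

lemma passages_of_arcs:
  assumes "x \<in> double_points L" "A \<in> set As" "A' \<in> set As" "A \<inter> A' = {}"
    and "a \<in> A" "b \<in> A'" "curve L a = x" "curve L b = x"
  shows "passages L x = {a, b}"
proof (rule passages_eqI[OF assms(1)])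
  show "a \<in> passages L x" using passage_arc[of A a L] assms by simp
  show "b \<in> passages L x" using passage_arc[of A' b L] assms by simp
  show "a \<noteq> b" using assms by auto
qed

text \<open>For moves that create crossings. The equation for the exponents is supplied by the graph
  lemma of the move: the new vertices enlarge the vertex set to \<open>X\<close> without affecting
  the old exponents.\<close>

lemma crossing_weight_outside:
  assumes "\<And>A. A \<in> set As \<Longrightarrow> even (card (bars K \<inter> A)) \<and> even (card (bars K' \<inter> A))"
    and none: "classical_crossings K \<inter> B = {}" and c: "c \<in> classical_crossings K"
    and e: "exponent X (linked K') c = exponent (classical_crossings K) (linked K') c"
  shows "crossing_weight K' X c = crossing_weight K (classical_crossings K) c"
proof -
  have cB: "c \<notin> B" using none c by auto
  have dp: "c \<in> double_points K" using c K.classical_subset by auto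
  then have dp': "c \<in> double_points K'" using double_points_eq cB by simp
  have "exponent (classical_crossings K) (linked K') c = exponent (classical_crossings K) (linked K) c"
    using none by (intro exponent_cong linked_eq) (use c in auto)
  moreover have "bar_parity K' 0 c = bar_parity K 0 c"
    by (rule bar_parity_outside[OF assms(1) dp cB])
  ultimately show ?thesis
    using bar_parity_1_eq[OF assms(1) dp dp'] e by (simp add: crossing_weight_def)
qed

text \<open>The loop of the kink lies in the single arc \<open>A\<close>, an interval away from the
  base point. It is therefore component 0 and contains no bar and no passage of another crossing. So
  \<open>x\<close> is isolated with exponent 0, and its weight has the factor
  \<open>1 - 1\<close>.\<close>

lemma Qz_reidemeister1:
  assumes As: "As = [A]" and nb: "no_bars K As" "no_bars K' As"
    and dp: "double_points K \<inter> B = {}" "double_points K' \<inter> B = {x}"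
    and x: "x \<in> classical_crossings K'"
  shows "Qz K = Qz K'"
proof -
  let ?C = "classical_crossings K"
  have xB: "x \<in> B" and xdp: "x \<in> double_points K'" using dp by auto
  have none: "?C \<inter> B = {}" using dp K.classical_subset by auto
  have C': "classical_crossings K' = insert x ?C"
    using classical_eq dp x K'.classical_subset none by blast
  have xC: "x \<notin> ?C" using none xB by auto
  obtain p q where pq: "passages K' x = {p, q}" "p \<noteq> q"
    using xdp by (rule double_point_passages)
  have "p \<in> U" "q \<in> U"
    using passages_memD[of p K' x] passages_memD[of q K' x] curve_in_B(2)[of p] curve_in_B(2)[of q]
      pq xB by auto
  then have "p \<in> A" "q \<in> A" using As by auto
  moreover have "A \<in> set As" using As by simp
  then obtain a b where "A = {a..b}" by (rule arcE)
  ultimately have inside: "t \<in> U" if "separates p q t" for t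
    using that As by (auto simp: separates_def)
  have L: "\<not> linked K' x c" if "c \<in> insert x ?C" for c
  proof (cases "c = x")
    case False
    then have c: "c \<in> ?C" "c \<notin> B" using that none by auto
    then obtain r s where rs: "passages K' c = {r, s}" "r \<noteq> s"
      using double_points_eq K.classical_subset by (metis double_point_passages subsetD)
    then have "r \<notin> U" "s \<notin> U"
      using passages_eq passage_outside c by blast+
    then have "\<not> separates p q r" "\<not> separates p q s"
      using inside by blast+
    then show ?thesis
      using linked_iff[OF pq(1) rs] by simp
  qed (use not_linked_self xdp in auto)
  have L': "\<not> linked K' c x" if "c \<in> ?C" for c
  proof -
    have "c \<in> double_points K'" using that C' K'.classical_subset by auto
    then show ?thesis using linked_sym[OF xdp] L that by auto
  qed
  note iso = exponent_isolated[where L = "linked K'", OF xC L L']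
  have "bars K' \<inter> component K' 0 x = {}"
    using inside nb component_0[OF pq(1)] by (auto simp: no_bars_def)
  then have "bar_parity K' 0 x = 0" by (simp add: bar_parity_def)
  then have x0: "crossing_weight K' (insert x ?C) x = 0"
    using iso(1) by (simp add: crossing_weight_def weight_def)
  have "crossing_weight K' (insert x ?C) c = crossing_weight K ?C c" if "c \<in> ?C" for c
    using crossing_weight_outside[OF no_bars_even[OF nb] none that] iso(2)[OF _ _ that] by simp
  moreover have "crossing_sign K' c = crossing_sign K c" if "c \<in> ?C" for c
    using sign_eq that none by blast
  ultimately show ?thesis
    unfolding K.Qz_eq K'.Qz_eq C' using xC K.finite_classical x0 by simp
qed

text \<open>Both new crossings run through \<open>A0\<close> and \<open>A1\<close>, so every old
  crossing is linked with both or with neither, and their bar parities agree. They have equal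
  weights and opposite signs.\<close>

lemma Qz_reidemeister2:
  assumes As: "As = [A0, A1]" and nb: "no_bars K As" "no_bars K' As"
    and dp: "double_points K \<inter> B = {}" "double_points K' \<inter> B = {x, y}"
    and x: "mark K' x = Classical t" "t \<in> A0" "t1 \<in> A1" "curve K' t = x" "curve K' t1 = x"
    and y: "mark K' y = Classical s" "s \<in> A0" "s1 \<in> A1" "curve K' s = y" "curve K' s1 = y"
    and xy: "x \<noteq> y" and sign: "crossing_sign K' x = - crossing_sign K' y"
  shows "Qz K = Qz K'"
proof -
  let ?C = "classical_crossings K"
  have arcs: "A0 \<in> set As" "A1 \<in> set As" "A0 \<inter> A1 = {}"
    using As nth_arcs_disjoint[of 0 1] by auto
  have xB: "x \<in> B" "y \<in> B" and xdp: "x \<in> double_points K'" "y \<in> double_points K'"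
    using dp by auto
  have none: "?C \<inter> B = {}" using dp K.classical_subset by auto
  have "x \<in> classical_crossings K'" "y \<in> classical_crossings K'"
    using xdp x y by (auto simp: classical_crossings_def)
  then have C': "classical_crossings K' = ?C \<union> {x, y}"
    using classical_eq dp K'.classical_subset none by blast
  have xC: "x \<notin> ?C" "y \<notin> ?C" using none xB by auto
  have p: "passages K' x = {t, t1}" "passages K' y = {s, s1}"
    using passages_of_arcs[OF xdp(1) arcs] passages_of_arcs[OF xdp(2) arcs] x y by simp_all
  have close: "close (passages K' x) (passages K' y)"
    using closeI[OF p arcs(1,2)] arcs(3) x y by auto
  have dpC: "c \<in> double_points K'" if "c \<in> ?C" for c
    using that C' K'.classical_subset by auto
  have Lx: "linked K' x c \<longleftrightarrow> linked K' y c" if "c \<in> ?C" for c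
  proof (rule linked_close[OF close refl dpC[OF that]])
    show "passages K' c \<inter> U = {}"
      using that none passages_eq passage_outside by blast
  qed
  have Lc: "linked K' c x \<longleftrightarrow> linked K' c y" if "c \<in> ?C" for c
    using Lx[OF that] linked_sym dpC[OF that] xdp by blast
  note twins = exponent_twins[of ?C x y "linked K'", OF K.finite_classical xC xy Lc Lx
      linked_sym[OF xdp] not_linked_self[OF xdp(1)] not_linked_self[OF xdp(2)]]
  have "bar_parity K' 0 x = bar_parity K' 0 y"
    using bar_parity_close[OF close refl] nb by (simp add: no_bars_def)
  then have "crossing_weight K' (?C \<union> {x, y}) x = crossing_weight K' (?C \<union> {x, y}) y"
    using twins(1) K'.bar_parity_1 xdp by (simp add: crossing_weight_def)
  moreover have "crossing_weight K' (?C \<union> {x, y}) c = crossing_weight K ?C c" if "c \<in> ?C" for c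
    using crossing_weight_outside[OF no_bars_even[OF nb] none that] twins(2)[OF _ _ that] by simp
  moreover have "crossing_sign K' c = crossing_sign K c" if "c \<in> ?C" for c
    using sign_eq that none by blast
  ultimately show ?thesis
    unfolding K.Qz_eq K'.Qz_eq C'
    using xC xy K.finite_classical sign by (subst sum.union_disjoint) auto
qed

lemma nth_arc: "i < length As \<Longrightarrow> As ! i \<in> set As"
  by simp

lemma triangle_crossing:
  assumes "triangle B As s L" "i < 3" "j < 3" "i \<noteq> j"
  shows "curve L (s i j) \<in> double_points L" "s i j \<in> As ! i" "curve L (s i j) = curve L (s j i)"
    "passages L (curve L (s i j)) = {s i j, s j i}"
proof -
  have mem: "s i j \<in> As ! i" "curve L (s i j) = curve L (s j i)" if "i < 3" "j < 3" "i \<noteq> j" for i j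
    using triangleD(3)[OF assms(1)] that by blast+
  have len: "length As = 3" using assms(1) by (rule triangleD)
  show *: "s i j \<in> As ! i" "curve L (s i j) = curve L (s j i)"
    using mem assms by blast+
  have "{curve L (s 0 1), curve L (s 0 2), curve L (s 1 2)} \<subseteq> double_points L"
    using triangleD(4)[OF assms(1)] by (metis inf_le1)
  then have "curve L (s 0 1) \<in> double_points L" "curve L (s 0 2) \<in> double_points L"
    "curve L (s 1 2) \<in> double_points L"
    by auto
  moreover have "i = 0 \<or> i = 1 \<or> i = 2" "j = 0 \<or> j = 1 \<or> j = 2"
    using assms by auto
  ultimately show dp: "curve L (s i j) \<in> double_points L"
    using mem(2)[of 0 1] mem(2)[of 0 2] mem(2)[of 1 2] assms(4) by auto
  show "passages L (curve L (s i j)) = {s i j, s j i}"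
    by (rule passages_of_arcs[OF dp nth_arc nth_arc nth_arcs_disjoint])
      (use mem[of i j] mem[of j i] assms len in simp_all)
qed

text \<open>Otherwise a point with only two passages would be passed in three disjoint arcs.\<close>

lemma triangle_distinct:
  assumes "triangle B As s L" "i < 3" "j < 3" "k < 3" "i \<noteq> j" "i \<noteq> k" "j \<noteq> k"
  shows "curve L (s i j) \<noteq> curve L (s i k)"
proof
  assume "curve L (s i j) = curve L (s i k)"
  then have "{s i j, s j i} = {s i k, s k i}"
    using triangle_crossing(4)[OF assms(1)] assms by metis
  then have "s k i \<in> {s i j, s j i}" by auto
  moreover have "s i j \<in> As ! i" "s j i \<in> As ! j" "s k i \<in> As ! k"
    using triangle_crossing(2)[OF assms(1)] assms by auto
  moreover have "length As = 3" using assms(1) by (rule triangleD)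
  ultimately show False
    using nth_arcs_disjoint[of i k] nth_arcs_disjoint[of j k] assms by auto
qed

text \<open>The two crossings share the arc \<open>i\<close>, on which their order is reversed,
  while their other passages stay in the disjoint arcs \<open>j\<close> and
  \<open>k\<close>.\<close>

lemma triangle_toggle:
  assumes mv: "triangle_move B As s s' K K'" and ijk: "i < 3" "j < 3" "k < 3" "i \<noteq> j" "i \<noteq> k" "j \<noteq> k"
  shows "linked K' (curve K' (s' i j)) (curve K' (s' i k)) \<longleftrightarrow>
    \<not> linked K (curve K (s i j)) (curve K (s i k))"
proof -
  have tri: "triangle B As s K" "triangle B As s' K'"
    using mv by (rule triangle_moveD)+
  have order: "s i j < s i k \<longleftrightarrow> s' i k < s' i j"
    using triangle_moveD(3)[OF mv] ijk by blast
  have len: "length As = 3" using tri(1) by (rule triangleD)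
  note mem = triangle_crossing(2)[OF tri(1)] triangle_crossing(2)[OF tri(2)]
  have disj: "As ! i \<inter> As ! j = {}" "As ! i \<inter> As ! k = {}" "As ! j \<inter> As ! k = {}"
    using nth_arcs_disjoint ijk len by auto
  obtain a b c d e f where int: "As ! i = {a..b}" "As ! j = {c..d}" "As ! k = {e..f}"
    using nth_arc arcE ijk len by metis
  have ne: "s i j \<noteq> s i k" "s' i j \<noteq> s' i k" "s i k \<noteq> s k i" "s' i k \<noteq> s' k i"
    using triangle_distinct[OF tri(1) ijk] triangle_distinct[OF tri(2) ijk] disj(2) mem ijk
    by (metis disjoint_iff)+
  show ?thesis
    using linked_iff[OF triangle_crossing(4)[OF tri(1)] triangle_crossing(4)[OF tri(1)], of i j i k]
      linked_iff[OF triangle_crossing(4)[OF tri(2)] triangle_crossing(4)[OF tri(2)], of i j i k]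
      separates_exchange[OF int disj, of "s i j" "s i k" "s' i j" "s' i k" "s j i" "s' j i" "s k i" "s' k i"]
      ne order mem ijk by simp
qed

lemma triangle_close:
  assumes "triangle B As s K" "triangle B As s' K'" "i < 3" "j < 3" "i \<noteq> j"
  shows "close (passages K (curve K (s i j))) (passages K' (curve K' (s' i j)))"
proof -
  have len: "length As = 3" using assms(1) by (rule triangleD)
  have mem: "s i j \<in> As ! i" "s' i j \<in> As ! i" "s j i \<in> As ! j" "s' j i \<in> As ! j"
    using triangle_crossing(2)[OF assms(1)] triangle_crossing(2)[OF assms(2)] assms by auto
  show ?thesis
    by (rule closeI[OF triangle_crossing(4)[OF assms(1,3-5)] triangle_crossing(4)[OF assms(2-5)]
          nth_arc nth_arc _ mem])
      (use nth_arcs_disjoint[of i j] mem len assms in auto)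
qed

lemma Qz_reidemeister3:
  assumes tw: "twisted_knot_diagram K" "twisted_knot_diagram K'"
    and mv: "triangle_move B As s s' K K'"
    and mk: "\<forall>(i, j) \<in> {(0, 1), (0, 2), (1, 2)}.
      mark K (curve K (s i j)) = Classical (s i j) \<and>
      mark K' (curve K' (s' i j)) = Classical (s' i j) \<and>
      crossing_sign K (curve K (s i j)) = crossing_sign K' (curve K' (s' i j))"
  shows "Qz K = Qz K'"
proof -
  have tri: "triangle B As s K" "triangle B As s' K'"
    using mv by (rule triangle_moveD)+
  note nb = triangleD(2)[OF tri(1)] triangleD(2)[OF tri(2)]
    and dp = triangleD(4)[OF tri(1)] triangleD(4)[OF tri(2)]
  define x y z where xyz: "x = curve K (s 0 1)" "y = curve K (s 0 2)" "z = curve K (s 1 2)"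
  define x' y' z' where xyz': "x' = curve K' (s' 0 1)" "y' = curve K' (s' 0 2)" "z' = curve K' (s' 1 2)"
  have T: "classical_crossings K \<inter> B = {x, y, z}" and T': "classical_crossings K' \<inter> B = {x', y', z'}"
    using dp mk unfolding xyz xyz' classical_crossings_def by fastforce+
  have alt: "x = curve K (s 1 0)" "y = curve K (s 2 0)" "z = curve K (s 2 1)"
    "x' = curve K' (s' 1 0)" "y' = curve K' (s' 2 0)" "z' = curve K' (s' 2 1)"
    unfolding xyz xyz' using triangle_crossing(3)[OF tri(1)] triangle_crossing(3)[OF tri(2)] by simp_all
  have ne: "x \<noteq> y" "x \<noteq> z" "y \<noteq> z"
    using triangle_distinct[OF tri(1), of 0 1 2] triangle_distinct[OF tri(1), of 1 0 2]
      triangle_distinct[OF tri(1), of 2 0 1] xyz alt by simp_all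
  have ne': "x' \<noteq> y'" "x' \<noteq> z'" "y' \<noteq> z'"
    using triangle_distinct[OF tri(2), of 0 1 2] triangle_distinct[OF tri(2), of 1 0 2]
      triangle_distinct[OF tri(2), of 2 0 1] xyz' alt by simp_all
  have in_dp: "{x, y, z} \<subseteq> double_points K" "{x', y', z'} \<subseteq> double_points K'"
    using T T' K.classical_subset K'.classical_subset by blast+
  have tog: "linked K' x' y' \<longleftrightarrow> \<not> linked K x y" "linked K' x' z' \<longleftrightarrow> \<not> linked K x z"
    "linked K' y' z' \<longleftrightarrow> \<not> linked K y z"
    using triangle_toggle[OF mv, of 0 1 2] triangle_toggle[OF mv, of 1 0 2]
      triangle_toggle[OF mv, of 2 0 1] xyz xyz' alt by simp_all
  have sym: "linked K y x = linked K x y" "linked K z x = linked K x z" "linked K z y = linked K y z"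
    "linked K' y' x' = linked K' x' y'" "linked K' z' x' = linked K' x' z'" "linked K' z' y' = linked K' y' z'"
    using linked_sym in_dp by blast+
  have self: "\<not> linked K c c" if "c \<in> {x, y, z}" for c
    using not_linked_self in_dp that by blast
  have self': "\<not> linked K' c c" if "c \<in> {x', y', z'}" for c
    using not_linked_self in_dp that by blast
  define f where "f c = (if c = x then x' else if c = y then y' else z')" for c
  have f: "f x = x'" "f y = y'" "f z = z'"
    using ne by (auto simp: f_def)
  have cl: "close (passages K x) (passages K' x')" "close (passages K y) (passages K' y')"
    "close (passages K z) (passages K' z')"
    unfolding xyz xyz' by (auto intro!: triangle_close[OF tri])
  show ?thesis
  proof (rule Qz_local[OF tw, where f = f and T = "{x, y, z}"])
    show "bij_betw f (classical_crossings K \<inter> B) (classical_crossings K' \<inter> B)"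
      unfolding T T' bij_betw_def inj_on_def using f ne ne' by auto
    show "{x, y, z} = {} \<or> card {x, y, z} = 3" using ne by simp
    \<comment> \<open>Each of the three arcs lies in one component of the smoothing at
      \<open>c\<close>, and \<open>c\<close> is linked with the crossing of two arcs iff these lie
      in different components. A distribution of three arcs over two components separates either
      none or exactly two of the three pairs.\<close>
    show "even (card {t \<in> {x, y, z}. linked K c t})" if c: "c \<in> classical_crossings K - {x, y, z}" for c
    proof -
      have cB: "c \<notin> B" and cdp: "c \<in> double_points K"
        using c T K.classical_subset by auto
      obtain p q where pq: "passages K c = {p, q}" "p \<noteq> q"
        using cdp by (rule double_point_passages)
      then have out: "p \<notin> U" "q \<notin> U" using passage_outside[OF cB] by auto
      have len: "length As = 3" using tri(1) by (rule triangleD)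
      have same: "separates p q (s i j) \<longleftrightarrow> separates p q (s i k)"
        if "i < 3" "j < 3" "k < 3" "i \<noteq> j" "i \<noteq> k" for i j k
      proof -
        have A: "As ! i \<in> set As" using that len by simp
        then obtain a b where "As ! i = {a..b}" by (rule arcE)
        then show ?thesis
          using separates_same_arc[of "As ! i" a b "s i j" "s i k" p q] out A
            triangle_crossing(2)[OF tri(1)] that by blast
      qed
      have l: "linked K c (curve K (s i j)) \<longleftrightarrow> separates p q (s i j) \<noteq> separates p q (s j i)"
        if "i < 3" "j < 3" "i \<noteq> j" for i j
      proof (rule linked_iff[OF pq(1) triangle_crossing(4)[OF tri(1) that]])
        have "s i j \<in> As ! i" "s j i \<in> As ! j"
          using triangle_crossing(2)[OF tri(1)] that by auto
        then show "s i j \<noteq> s j i"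
          using nth_arcs_disjoint[of i j] len that by auto
      qed
      show ?thesis
        unfolding card_triple_filter[OF ne] unfolding xyz
        using l[of 0 1] l[of 0 2] l[of 1 2] same[of 0 1 2] same[of 1 0 2] same[of 2 0 1]
        by auto
    qed
    show "close (passages K c) (passages K' (f c))" if "c \<in> classical_crossings K \<inter> B" for c
      using that cl f unfolding T by auto
    show "linked K' (f c) (f d) \<longleftrightarrow> (linked K c d \<noteq> (c \<in> {x, y, z} \<and> d \<in> {x, y, z} \<and> c \<noteq> d))"
      if "c \<in> classical_crossings K \<inter> B" "d \<in> classical_crossings K \<inter> B" for c d
      using that tog sym self self' f ne unfolding T by auto
    show "crossing_sign K' (f c) = crossing_sign K c" if "c \<in> classical_crossings K \<inter> B" for c
      using that mk f unfolding T xyz xyz' by auto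
    show "even (card (bars K \<inter> A)) \<and> even (card (bars K' \<inter> A))" if "A \<in> set As" for A
      using no_bars_even[OF nb that] .
    show "bar_parity K' 0 (f c) = bar_parity K 0 c" if "c \<in> classical_crossings K \<inter> B" for c
      using that bar_parity_close[OF _ no_bars_eq[OF nb, symmetric], of c "f c"] nb cl f
      unfolding T no_bars_def by auto
  qed (simp add: T)
qed

text \<open>Virtual crossings are no vertices of the graph, so the new order along the arcs is
  invisible; only the one classical crossing has to be matched.\<close>

lemma Qz_virtual4:
  assumes tw: "twisted_knot_diagram K" "twisted_knot_diagram K'"
    and mv: "triangle_move B As s s' K K'"
    and mk: "mark K (curve K (s 0 1)) = Classical (s 0 1)"
      "mark K' (curve K' (s' 0 1)) = Classical (s' 0 1)"
      "crossing_sign K (curve K (s 0 1)) = crossing_sign K' (curve K' (s' 0 1))"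
    and virt: "\<forall>(i, j) \<in> {(0, 2), (1, 2)}.
      mark K (curve K (s i j)) = Virtual \<and> mark K' (curve K' (s' i j)) = Virtual"
  shows "Qz K = Qz K'"
proof -
  have tri: "triangle B As s K" "triangle B As s' K'"
    using mv by (rule triangle_moveD)+
  note nb = triangleD(2)[OF tri(1)] triangleD(2)[OF tri(2)]
    and dp = triangleD(4)[OF tri(1)] triangleD(4)[OF tri(2)]
  have cl: "close (passages K (curve K (s 0 1))) (passages K' (curve K' (s' 0 1)))"
    by (rule triangle_close[OF tri]) auto
  show ?thesis
  proof (rule Qz_local_single[OF tw])
    show "classical_crossings K \<inter> B = {curve K (s 0 1)}"
      "classical_crossings K' \<inter> B = {curve K' (s' 0 1)}"
      using dp mk virt unfolding classical_crossings_def by fastforce+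
    show "bar_parity K' 0 (curve K' (s' 0 1)) = bar_parity K 0 (curve K (s 0 1))"
      using bar_parity_close[OF cl no_bars_eq[OF nb, symmetric]] nb by (simp add: no_bars_def)
  qed (use cl mk no_bars_even[OF nb] in auto)
qed

text \<open>The weight does not see the exchange of over and under, and the sign is kept. What
  remains is that removing the four bars preserves all parities: outside crossings lose two bars per
  arc, and the crossing in the disc is treated by the set \<open>W\<close>.\<close>

lemma Qz_twisted3:
  assumes tw: "twisted_knot_diagram K" "twisted_knot_diagram K'"
    and As: "As = [A0, A1]"
    and t: "t0 \<in> A0" "t1 \<in> A1" "curve K t0 = curve K t1"
    and dp: "double_points K \<inter> B = {curve K t0}" "mark K (curve K t0) = Classical t0"
    and b: "bars K \<inter> A0 = {a0, b0}" "a0 < t0" "t0 < b0" "bars K \<inter> A1 = {a1, b1}" "a1 < t1" "t1 < b1"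
    and nb: "no_bars K' As"
    and q: "q0 \<in> A0" "q1 \<in> A1" "curve K' q0 = curve K' q1"
    and dp': "double_points K' \<inter> B = {x, curve K' q0, y}" "mark K' x = Virtual" "mark K' y = Virtual"
      "mark K' (curve K' q0) = Classical q1"
    and sign: "crossing_sign K' (curve K' q0) = crossing_sign K (curve K t0)"
  shows "Qz K = Qz K'"
proof -
  have arcs: "A0 \<in> set As" "A1 \<in> set As" "A0 \<inter> A1 = {}"
    using As nth_arcs_disjoint[of 0 1] by auto
  obtain l0 h0 l1 h1 where int: "A0 = {l0..h0}" "A1 = {l1..h1}"
    using arcE arcs by metis
  have xdp: "curve K t0 \<in> double_points K" "curve K' q0 \<in> double_points K'"
    using dp dp' by auto
  have p: "passages K (curve K t0) = {t0, t1}" "passages K' (curve K' q0) = {q0, q1}"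
    using passages_of_arcs[OF xdp(1) arcs] passages_of_arcs[OF xdp(2) arcs] t q by simp_all
  have cl: "close (passages K (curve K t0)) (passages K' (curve K' q0))"
    using closeI[OF p arcs(1,2)] arcs(3) t q by auto
  have fin: "finite (bars K)"
    using K.diagram by (simp add: singular_twisted_knot_diagram_def)
  have even: "even (card (bars K \<inter> A)) \<and> even (card (bars K' \<inter> A))" if "A \<in> set As" for A
  proof -
    have "bars K' \<inter> A = {}" using nb that by (auto simp: no_bars_def)
    then show ?thesis using that As b by auto
  qed
  have bK': "bars K' = bars K - U"
    using bars_eq nb by (auto simp: no_bars_def)
  have bK: "bars K = (bars K - U) \<union> {a0, b0, a1, b1}"
    using b As by auto
  have in_arcs: "{a0, b0} \<subseteq> A0" "{a1, b1} \<subseteq> A1" using b by auto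
  have "separates q0 q1 r \<longleftrightarrow> separates t0 t1 r" if "r \<notin> U" for r
    using separates_arcs[OF int, of q0 t0 q1 t1 r] that arcs t q by auto
  then have 1: "bars K' \<inter> component K' 0 (curve K' q0) = {r \<in> bars K - U. separates t0 t1 r}"
    unfolding bK' component_0[OF p(2)] by auto
  define W where "W = {r \<in> {a0, b0, a1, b1}. separates t0 t1 r}"
  \<comment> \<open>Between the two passages lie the end of the earlier arc and the beginning of the
    later one, hence one of the two bars of each arc.\<close>
  have "W = (if t0 < t1 then {b0, a1} else {a0, b1})"
    unfolding W_def using in_arcs arcs(3) int b t by (auto simp: separates_def)
  moreover have "b0 \<noteq> a1" "a0 \<noteq> b1" using in_arcs arcs(3) by auto
  ultimately have "card W = 2" by simp
  have "bars K \<inter> component K 0 (curve K t0) = {r \<in> bars K - U. separates t0 t1 r} \<union> W"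
    unfolding component_0[OF p(1)] W_def using bK by auto
  moreover have "W \<subseteq> U" unfolding W_def using in_arcs arcs by auto
  then have "card ({r \<in> bars K - U. separates t0 t1 r} \<union> W) = card {r \<in> bars K - U. separates t0 t1 r} + card W"
    using fin by (intro card_Un_disjoint) (auto simp: W_def)
  ultimately have "bar_parity K' 0 (curve K' q0) = bar_parity K 0 (curve K t0)"
    using \<open>card W = 2\<close> 1 by (simp add: bar_parity_def)
  moreover have "classical_crossings K \<inter> B = {curve K t0}"
    using dp unfolding classical_crossings_def by fastforce
  moreover have "classical_crossings K' \<inter> B = {curve K' q0}"
    unfolding classical_crossings_Int dp'(1) using dp' by auto
  ultimately show ?thesis
    by (intro Qz_local_single[OF tw _ _ cl sign even])
qed

end

section \<open>Moves that change only the bars\<close>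

lemma Qz_bars_only:
  assumes tw: "twisted_knot_diagram K" "twisted_knot_diagram K'"
    and same: "curve K' = curve K" "mark K' = mark K"
    and "\<And>c l. c \<in> classical_crossings K \<Longrightarrow> l \<in> {0, 1} \<Longrightarrow> bar_parity K' l c = bar_parity K l c"
  shows "Qz K = Qz K'"
proof -
  have p: "passages K' = passages K" and v: "velocity K' = velocity K"
    by (intro ext; simp add: passages_def velocity_def same)+
  then have cc: "classical_crossings K' = classical_crossings K"
    using same by (simp add: classical_crossings_def double_points_def)
  have comp: "component K' = component K"
    by (intro ext) (simp only: component_def p)
  have sign: "crossing_sign K' = crossing_sign K"
    by (intro ext) (simp only: crossing_sign_def same p v)
  show ?thesis
    by (rule Qz_transfer[OF tw, where F = id and T = "{}"])
      (use assms p cc comp sign in \<open>auto simp: linked_def\<close>)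
qed

lemma component_interval:
  assumes "c \<in> double_points K" "0 \<le> a" "a < b" "b < 1" "{a..b} \<inter> passages K c = {}" "l \<in> {0, 1}"
  shows "a \<in> component K l c \<longleftrightarrow> b \<in> component K l c"
proof -
  obtain p q where pq: "passages K c = {p, q}" "p \<noteq> q"
    using assms(1) by (rule double_point_passages)
  then have "p \<notin> {a..b}" "q \<notin> {a..b}" using assms by auto
  moreover from this have "separates p q a \<longleftrightarrow> separates p q b"
    using separates_same_arc[of "{a..b}" a b a b p q] assms by auto
  ultimately show ?thesis
    using component_0[OF pq(1)] component_1[OF pq(1)] assms by auto
qed

text \<open>The only double point between the old and the new position of the bar is virtual, so for
  each classical crossing both positions lie on the same component.\<close>

lemma Qz_twisted1:
  assumes tw: "twisted_knot_diagram K" "twisted_knot_diagram K'" and mv: "twisted1 K K'"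
  shows "Qz K = Qz K'"
proof -
  interpret knot_diagram K using tw(1) by (rule twisted_imp_knot_diagram)
  have fin: "finite (bars K)" using diagram by (simp add: singular_twisted_knot_diagram_def)
  obtain a b r where same: "curve K' = curve K" "mark K' = mark K" and ab: "0 \<le> a" "a < b" "b < 1"
    and r: "{t \<in> {a..b}. curve K t \<in> double_points K} = {r}" "mark K (curve K r) = Virtual"
    and bars: "bars K \<inter> {a..b} = {a}" "bars K' = insert b (bars K - {a})"
    using mv unfolding twisted1_def by blast
  show ?thesis
  proof (rule Qz_bars_only[OF tw same])
    fix c l assume c: "c \<in> classical_crossings K" and l: "l \<in> {0, 1 :: nat}"
    have dp: "c \<in> double_points K" using c classical_subset by auto
    have "t \<notin> passages K c" if "t \<in> {a..b}" for t
    proof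
      assume "t \<in> passages K c"
      then have "curve K t = c" by (simp add: passages_def)
      then have "t = r" using r(1) that dp by blast
      then show False using c r(2) \<open>curve K t = c\<close> by (auto simp: classical_crossings_def)
    qed
    then have iff: "a \<in> component K l c \<longleftrightarrow> b \<in> component K l c"
      using component_interval[OF dp ab _ l] by blast
    have "component K' l c = component K l c"
      using same by (simp add: component_def passages_def)
    moreover have "a \<in> bars K" "b \<notin> bars K" using bars(1) ab by auto
    ultimately have "bars K' \<inter> component K' l c =
        (if a \<in> component K l c then insert b (bars K \<inter> component K l c - {a}) else bars K \<inter> component K l c)"
      using bars(2) iff by auto
    moreover have "card (insert b (bars K \<inter> component K l c - {a})) = card (bars K \<inter> component K l c)"
      if "a \<in> component K l c"
    proof -
      have "card (insert b (bars K \<inter> component K l c - {a})) = Suc (card (bars K \<inter> component K l c - {a}))"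
        using \<open>b \<notin> bars K\<close> fin by (intro card_insert_disjoint) auto
      then show ?thesis
        using that \<open>a \<in> bars K\<close> fin card_Suc_Diff1[of "bars K \<inter> component K l c" a] by simp
    qed
    ultimately show "bar_parity K' l c = bar_parity K l c"
      by (simp add: bar_parity_def)
  qed
qed

lemma Qz_twisted2:
  assumes tw: "twisted_knot_diagram K" "twisted_knot_diagram K'" and mv: "twisted2 K K'"
  shows "Qz K = Qz K'"
proof -
  interpret knot_diagram K using tw(1) by (rule twisted_imp_knot_diagram)
  have fin: "finite (bars K)" using diagram by (simp add: singular_twisted_knot_diagram_def)
  obtain a b where same: "curve K' = curve K" "mark K' = mark K" and ab: "0 \<le> a" "a < b" "b < 1"
    and none: "{t \<in> {a..b}. curve K t \<in> double_points K} = {}"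
    and bars: "bars K \<inter> {a..b} = {}" "bars K' = bars K \<union> {a, b}"
    using mv unfolding twisted2_def by blast
  show ?thesis
  proof (rule Qz_bars_only[OF tw same])
    fix c l assume c: "c \<in> classical_crossings K" and l: "l \<in> {0, 1 :: nat}"
    have dp: "c \<in> double_points K" using c classical_subset by auto
    have "{a..b} \<inter> passages K c = {}"
      using none dp by (auto simp: passages_def)
    then have iff: "a \<in> component K l c \<longleftrightarrow> b \<in> component K l c"
      by (rule component_interval[OF dp ab _ l])
    have "component K' l c = component K l c"
      using same by (simp add: component_def passages_def)
    moreover have ab': "a \<notin> bars K" "b \<notin> bars K" using bars(1) ab by auto
    ultimately have "bars K' \<inter> component K' l c = (bars K \<inter> component K l c) \<union>
        (if a \<in> component K l c then {a, b} else {})"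
      using bars(2) iff by auto
    moreover have "card ((bars K \<inter> component K l c) \<union> {a, b}) = card (bars K \<inter> component K l c) + 2"
      using ab' fin ab by (subst card_Un_disjoint) auto
    ultimately show "bar_parity K' l c = bar_parity K l c"
      by (simp add: bar_parity_def)
  qed
qed

section \<open>Isotopies and changes of the parametrization\<close>

text \<open>The factor \<open>wedge (f 1) (f \<i>)\<close> is the determinant of \<open>f\<close>;
  when it is positive, crossing signs are kept.\<close>

lemma wedge_linear:
  assumes "linear f"
  shows "wedge (f a) (f b) = wedge (f 1) (f \<i>) * wedge a b"
proof -
  have f: "f z = Re z *\<^sub>R f 1 + Im z *\<^sub>R f \<i>" for z
  proof -
    have "z = Re z *\<^sub>R 1 + Im z *\<^sub>R \<i>" by (simp add: complex_eq_iff)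
    then have "f z = f (Re z *\<^sub>R 1 + Im z *\<^sub>R \<i>)" by simp
    also have "\<dots> = Re z *\<^sub>R f 1 + Im z *\<^sub>R f \<i>"
      using assms by (simp only: linear_add linear_scale)
    finally show ?thesis .
  qed
  show ?thesis
    unfolding f[of a] f[of b] wedge_def by (simp add: algebra_simps)
qed

lemma wedge_scaleR: "wedge (r *\<^sub>R a) (s *\<^sub>R b) = r * s * wedge a b"
  by (simp add: wedge_def algebra_simps)

lemma (in knot_diagram) has_velocity: "(curve K has_vector_derivative velocity K t) (at t)"
  using diagram unfolding singular_twisted_knot_diagram_def C1_differentiable_on_eq velocity_def
  by (simp add: vector_derivative_works)

lemma (in knot_diagram) periodic: "curve K (t + 1) = curve K t"
  using diagram unfolding singular_twisted_knot_diagram_def by blast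

lemma (in knot_diagram) periodic_int: "curve K (t + of_int n) = curve K t"
proof (induction n rule: int_induct[where k = 0])
  case (step1 i)
  then show ?case using periodic[of "t + of_int i"] by (simp add: add.assoc)
next
  case (step2 i)
  then show ?case using periodic[of "t + of_int (i - 1)"] by simp
qed simp

text \<open>All passages and bars keep their times, so the graph and the bar parities are carried
  over as they are. Only the signs require the derivative of the map.\<close>

lemma Qz_plane_isotopy:
  assumes tw: "twisted_knot_diagram K" "twisted_knot_diagram K'" and mv: "plane_isotopy K K'"
  shows "Qz K = Qz K'"
proof -
  interpret K: knot_diagram K using tw(1) by (rule twisted_imp_knot_diagram)
  interpret K': knot_diagram K' using tw(2) by (rule twisted_imp_knot_diagram)
  obtain \<phi> \<phi>' where "bij \<phi>" and der: "\<And>x. (\<phi> has_derivative \<phi>' x) (at x)"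
    and pos: "\<And>x. wedge (\<phi>' x 1) (\<phi>' x \<i>) > 0" and curve: "curve K' = \<phi> \<circ> curve K"
    and bars: "bars K' = bars K" and mk: "\<And>x. x \<in> double_points K \<Longrightarrow> mark K' (\<phi> x) = mark K x"
    using mv unfolding plane_isotopy_def by blast
  have inj: "\<phi> x = \<phi> y \<longleftrightarrow> x = y" for x y
    using \<open>bij \<phi>\<close> by (meson bij_is_inj injD)
  have p: "passages K' (\<phi> x) = passages K x" for x
    by (simp add: passages_def curve inj)
  then have dp: "\<phi> x \<in> double_points K' \<longleftrightarrow> x \<in> double_points K" for x
    by (simp add: double_points_def)
  have cc: "\<phi> x \<in> classical_crossings K' \<longleftrightarrow> x \<in> classical_crossings K" for x
    using mk dp by (auto simp: classical_crossings_def)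
  have comp: "component K' l (\<phi> x) = component K l x" for l x
    by (simp add: component_def p)
  have vel: "velocity K' t = \<phi>' (curve K t) (velocity K t)" for t
  proof -
    have "(\<phi> \<circ> curve K has_derivative \<phi>' (curve K t) \<circ> (\<lambda>h. h *\<^sub>R velocity K t)) (at t)"
      using K.has_velocity der unfolding has_vector_derivative_def by (intro diff_chain_at)
    moreover have "\<phi>' (curve K t) (h *\<^sub>R v) = h *\<^sub>R \<phi>' (curve K t) v" for h v
      using der has_derivative_linear linear_scale by blast
    ultimately have "(curve K' has_vector_derivative \<phi>' (curve K t) (velocity K t)) (at t)"
      unfolding has_vector_derivative_def curve by (simp add: o_def)
    then show ?thesis
      unfolding velocity_def[of K'] by (rule vector_derivative_at)
  qed
  show ?thesis
  proof (rule Qz_transfer[OF tw, where F = \<phi> and T = "{}"])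
    show "bij_betw \<phi> (classical_crossings K) (classical_crossings K')"
    proof (rule bij_betw_subset[of \<phi> UNIV UNIV])
      show "\<phi> ` classical_crossings K = classical_crossings K'"
        using cc \<open>bij \<phi>\<close> by (metis bij_image_Collect_eq bij_is_surj image_subset_iff subset_antisym subsetI surjD image_eqI)
    qed (use \<open>bij \<phi>\<close> in auto)
    fix c assume c: "c \<in> classical_crossings K"
    obtain a b where ab: "mark K c = Classical a" "passages K c = {a, b}" "a \<noteq> b"
      using c by (rule K.classicalE)
    then have "curve K a = c" "curve K b = c"
      using passages_memD by blast+
    moreover have "mark K' (\<phi> c) = Classical a"
      using mk c ab K.classical_subset by auto
    moreover have "linear (\<phi>' c)"
      using der by (rule has_derivative_linear)
    ultimately show "crossing_sign K' (\<phi> c) = crossing_sign K c"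
      using K.crossing_sign_eq[OF ab] K'.crossing_sign_eq[of "\<phi> c" a b] ab p pos[of c]
      by (simp add: vel wedge_linear[of _ "velocity K a" "velocity K b"] zero_less_mult_iff)
    show "{#bar_parity K' 0 (\<phi> c), bar_parity K' 1 (\<phi> c)#} = {#bar_parity K 0 c, bar_parity K 1 c#}"
      by (simp add: bar_parity_def comp bars)
  qed (simp_all add: linked_def comp p)
qed

text \<open>The floor of \<open>\<rho>\<close> jumps at most once during a period. Hence
  \<open>frac\<close> cuts the times into a block before and a block after the jump, keeps the order
  within each block and puts the later block first.\<close>

lemma frac_less_iff:
  fixes \<rho> :: "real \<Rightarrow> real"
  assumes mono: "strict_mono \<rho>" and turn: "\<rho> 1 = \<rho> 0 + 1"
    and st: "s \<in> {0..<1}" "t \<in> {0..<1}" "s < t"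
  shows "frac (\<rho> s) < frac (\<rho> t) \<longleftrightarrow> \<lfloor>\<rho> s\<rfloor> = \<lfloor>\<rho> t\<rfloor>"
    and "frac (\<rho> t) < frac (\<rho> s) \<longleftrightarrow> \<lfloor>\<rho> s\<rfloor> \<noteq> \<lfloor>\<rho> t\<rfloor>"
    and "\<lfloor>\<rho> t\<rfloor> = \<lfloor>\<rho> 0\<rfloor> \<Longrightarrow> \<lfloor>\<rho> s\<rfloor> = \<lfloor>\<rho> 0\<rfloor>"
    and "\<lfloor>\<rho> s\<rfloor> \<noteq> \<lfloor>\<rho> 0\<rfloor> \<Longrightarrow> \<lfloor>\<rho> t\<rfloor> = \<lfloor>\<rho> s\<rfloor>"
proof -
  have range: "\<rho> 0 \<le> \<rho> s" "\<rho> s < \<rho> t" "\<rho> t < \<rho> 0 + 1"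
    using mono st by (simp_all add: strict_mono_less_eq strict_mono_less flip: turn)
  have "\<lfloor>\<rho> 0\<rfloor> \<le> \<lfloor>\<rho> s\<rfloor>" "\<lfloor>\<rho> s\<rfloor> \<le> \<lfloor>\<rho> t\<rfloor>" "\<lfloor>\<rho> t\<rfloor> \<le> \<lfloor>\<rho> 0\<rfloor> + 1"
    using range floor_mono[of "\<rho> t" "\<rho> 0 + 1"] by (simp_all add: floor_mono)
  then have floors: "\<lfloor>\<rho> s\<rfloor> = \<lfloor>\<rho> t\<rfloor> \<or> \<lfloor>\<rho> s\<rfloor> = \<lfloor>\<rho> 0\<rfloor> \<and> \<lfloor>\<rho> t\<rfloor> = \<lfloor>\<rho> 0\<rfloor> + 1"
    by linarith
  then show "\<lfloor>\<rho> t\<rfloor> = \<lfloor>\<rho> 0\<rfloor> \<Longrightarrow> \<lfloor>\<rho> s\<rfloor> = \<lfloor>\<rho> 0\<rfloor>"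
    "\<lfloor>\<rho> s\<rfloor> \<noteq> \<lfloor>\<rho> 0\<rfloor> \<Longrightarrow> \<lfloor>\<rho> t\<rfloor> = \<lfloor>\<rho> s\<rfloor>"
    by linarith+
  have "\<lfloor>\<rho> s\<rfloor> = \<lfloor>\<rho> t\<rfloor> \<Longrightarrow> frac (\<rho> s) < frac (\<rho> t)"
    using range by (simp add: frac_def)
  moreover have "\<lfloor>\<rho> s\<rfloor> \<noteq> \<lfloor>\<rho> t\<rfloor> \<Longrightarrow> frac (\<rho> t) < frac (\<rho> s)"
  proof -
    assume "\<lfloor>\<rho> s\<rfloor> \<noteq> \<lfloor>\<rho> t\<rfloor>"
    then have "\<lfloor>\<rho> s\<rfloor> = \<lfloor>\<rho> 0\<rfloor>" "\<lfloor>\<rho> t\<rfloor> = \<lfloor>\<rho> 0\<rfloor> + 1"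
      using floors by blast+
    then show "frac (\<rho> t) < frac (\<rho> s)"
      using range unfolding frac_def by simp
  qed
  ultimately show "frac (\<rho> s) < frac (\<rho> t) \<longleftrightarrow> \<lfloor>\<rho> s\<rfloor> = \<lfloor>\<rho> t\<rfloor>"
    "frac (\<rho> t) < frac (\<rho> s) \<longleftrightarrow> \<lfloor>\<rho> s\<rfloor> \<noteq> \<lfloor>\<rho> t\<rfloor>"
    by (meson less_asym)+
qed

text \<open>
  A cyclic shift of the times preserves which times lie between two given ones, or exchanges
  them with those that lie outside.
\<close>

lemma separates_frac:
  fixes \<rho> :: "real \<Rightarrow> real"
  assumes mono: "strict_mono \<rho>" and turn: "\<rho> 1 = \<rho> 0 + 1"
    and ab: "a \<in> {0..<1}" "b \<in> {0..<1}" "a \<noteq> b"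
    and t: "t \<in> {0..<1}" "t \<noteq> a" "t \<noteq> b"
  shows "separates (frac (\<rho> a)) (frac (\<rho> b)) (frac (\<rho> t)) \<longleftrightarrow>
    (separates a b t \<longleftrightarrow> \<lfloor>\<rho> a\<rfloor> = \<lfloor>\<rho> b\<rfloor>)"
proof -
  \<comment> \<open>\<open>P x\<close> says that \<open>x\<close> lies before the jump of the floor.
    The order of fractional parts becomes a Boolean combination of \<open>P\<close> and the order of
    the times, and the monotonicity of \<open>P\<close> settles each position of
    \<open>t\<close>.\<close>
  define P where "P x \<longleftrightarrow> \<lfloor>\<rho> x\<rfloor> = \<lfloor>\<rho> 0\<rfloor>" for x
  have P_mono: "P y \<longrightarrow> P x" if "x \<in> {0..<1}" "y \<in> {0..<1}" "x < y" for x y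
    using frac_less_iff(3)[OF mono turn that] unfolding P_def by blast
  have P_eq: "\<lfloor>\<rho> x\<rfloor> = \<lfloor>\<rho> y\<rfloor> \<longleftrightarrow> (P x \<longleftrightarrow> P y)" if "x \<in> {0..<1}" "y \<in> {0..<1}" for x y
    using frac_less_iff(4)[OF mono turn, of x y] frac_less_iff(4)[OF mono turn, of y x] that
    unfolding P_def by (cases x y rule: linorder_cases) auto
  have less: "frac (\<rho> x) < frac (\<rho> y) \<longleftrightarrow> (x < y \<longleftrightarrow> P x \<longleftrightarrow> P y)"
    if "x \<in> {0..<1}" "y \<in> {0..<1}" "x \<noteq> y" for x y
    using frac_less_iff(1,2)[OF mono turn, of x y] frac_less_iff(1,2)[OF mono turn, of y x] that
      P_eq[OF that(1,2)] P_eq[OF that(2,1)]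
    by (cases "x < y") auto
  have increasing: "separates (frac (\<rho> a)) (frac (\<rho> b)) (frac (\<rho> t)) \<longleftrightarrow>
      (separates a b t \<longleftrightarrow> \<lfloor>\<rho> a\<rfloor> = \<lfloor>\<rho> b\<rfloor>)"
    if I: "a \<in> {0..<1}" "b \<in> {0..<1}" "t \<noteq> a" "t \<noteq> b" and "a < b" for a b
  proof -
    note unfold = separates_def P_eq[OF I(1,2)] less[OF I(1) t(1) I(3)[symmetric]] less[OF t(1) I(2,4)]
      less[OF I(2) t(1) I(4)[symmetric]] less[OF t(1) I(1,3)]
    consider "t < a" | "a < t" "t < b" | "b < t"
      using I by linarith
    then show ?thesis
    proof cases
      case 1
      then have "(a < t) = False" "(t < b) = True" "(b < t) = False" "(t < a) = True"
        using \<open>a < b\<close> by auto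
      then show ?thesis
        unfolding unfold using P_mono[OF t(1) I(1) 1] P_mono[OF I(1,2) \<open>a < b\<close>] by (simp only:) blast
    next
      case 2
      then have "(a < t) = True" "(t < b) = True" "(b < t) = False" "(t < a) = False"
        by auto
      then show ?thesis
        unfolding unfold using P_mono[OF I(1) t(1) 2(1)] P_mono[OF t(1) I(2) 2(2)] by (simp only:) blast
    next
      case 3
      then have "(a < t) = True" "(t < b) = False" "(b < t) = True" "(t < a) = False"
        using \<open>a < b\<close> by auto
      then show ?thesis
        unfolding unfold using P_mono[OF I(1,2) \<open>a < b\<close>] P_mono[OF I(2) t(1) 3] by (simp only:) blast
    qed
  qed
  have "separates x y z \<longleftrightarrow> separates y x z" for x y z
    by (auto simp: separates_def)
  then show ?thesis
    using increasing[of a b] increasing[of b a] ab t by (cases "a < b") auto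
qed

lemma bij_betw_frac:
  fixes \<rho> :: "real \<Rightarrow> real"
  assumes mono: "strict_mono \<rho>" and turn: "\<rho> 1 = \<rho> 0 + 1" and cont: "continuous_on UNIV \<rho>"
  shows "bij_betw (\<lambda>t. frac (\<rho> t)) {0..<1} {0..<1}"
  unfolding bij_betw_def
proof
  show "inj_on (\<lambda>t. frac (\<rho> t)) {0..<1}"
  proof (rule linorder_inj_onI')
    fix s t :: real assume "s \<in> {0..<1}" "t \<in> {0..<1}" "s < t"
    from frac_less_iff(1,2)[OF mono turn this] show "frac (\<rho> s) \<noteq> frac (\<rho> t)"
      by auto
  qed
  have "y \<in> (\<lambda>t. frac (\<rho> t)) ` {0..<1}" if "y \<in> {0..<1}" for y
  proof -
    \<comment> \<open>The shift by \<open>k\<close> moves \<open>y\<close> into the interval of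
      values that \<open>\<rho>\<close> takes during one period, where the intermediate value
      theorem finds a time.\<close>
    define k where "k = \<lceil>\<rho> 0 - y\<rceil>"
    have k: "\<rho> 0 \<le> y + of_int k" "y + of_int k < \<rho> 0 + 1"
      unfolding k_def by linarith+
    have "\<exists>t. 0 \<le> t \<and> t \<le> 1 \<and> \<rho> t = y + of_int k"
      using k turn cont by (intro IVT') (auto intro: continuous_on_subset)
    then obtain t where t: "0 \<le> t" "t \<le> 1" "\<rho> t = y + of_int k"
      by blast
    have "t \<noteq> 1" using t(3) k(2) turn by auto
    moreover have "frac (\<rho> t) = y"
      using that t(3) by (simp add: frac_unique_iff)
    ultimately show ?thesis
      using t by (intro image_eqI[of _ _ t]) auto
  qed
  then show "(\<lambda>t. frac (\<rho> t)) ` {0..<1} = {0..<1}"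
    by (auto simp: frac_lt_1)
qed

text \<open>The map \<open>g\<close> turns times of \<open>K'\<close> into times of
  \<open>K\<close>, and the crossings are the same points. If the passages \<open>a\<close> and
  \<open>b\<close> of a crossing have different floors, its components are exchanged: separation by
  \<open>a\<close> and \<open>b\<close> is negated for all other times at once, so its links stay
  the same and its bar parities are swapped.\<close>

lemma Qz_reparametrization:
  assumes tw: "twisted_knot_diagram K" "twisted_knot_diagram K'" and mv: "reparametrization K K'"
  shows "Qz K = Qz K'"
proof -
  interpret K: knot_diagram K using tw(1) by (rule twisted_imp_knot_diagram)
  interpret K': knot_diagram K' using tw(2) by (rule twisted_imp_knot_diagram)
  obtain \<rho> \<rho>' where der: "\<And>t. (\<rho> has_real_derivative \<rho>' t) (at t)" and pos: "\<And>t. \<rho>' t > 0"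
    and shift: "\<And>t. \<rho> (t + 1) = \<rho> t + 1" and curve: "curve K' = curve K \<circ> \<rho>"
    and bars: "bars K' = {t \<in> {0..<1}. frac (\<rho> t) \<in> bars K}"
    and mk: "\<forall>x \<in> double_points K.
           mark K x = (case mark K' x of Classical u \<Rightarrow> Classical (frac (\<rho> u)) | m \<Rightarrow> m)"
    using mv unfolding reparametrization_def by blast
  define g where "g t = frac (\<rho> t)" for t
  have mono: "strict_mono \<rho>"
  proof (rule strict_monoI)
    fix x y :: real assume "x < y"
    then show "\<rho> x < \<rho> y"
      by (rule DERIV_pos_imp_increasing) (use der pos in blast)
  qed
  have turn: "\<rho> 1 = \<rho> 0 + 1"
    using shift[of 0] by simp
  have "continuous_on UNIV \<rho>"
    using der by (meson DERIV_continuous_on has_field_derivative_at_within)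
  from bij_betw_frac[OF mono turn this]
  have inj: "inj_on g {0..<1}" and surj: "g ` {0..<1} = {0..<1}"
    unfolding g_def bij_betw_def by blast+
  have curve_g: "curve K (g t) = curve K' t" for t
    using K.periodic_int[of "g t" "\<lfloor>\<rho> t\<rfloor>"] by (simp add: curve g_def frac_def)
  have p: "passages K x = g ` passages K' x" for x
  proof -
    have "passages K x = {t \<in> g ` {0..<1}. curve K t = x}"
      unfolding surj passages_def ..
    then show ?thesis
      by (auto simp: passages_def curve_g)
  qed
  have inj_p: "inj_on g (passages K' x)" for x
    using inj by (rule inj_on_subset) (auto simp: passages_def)
  have dp: "double_points K' = double_points K"
    unfolding double_points_def p by (simp add: card_image[OF inj_p])
  have cc: "classical_crossings K' = classical_crossings K"
  proof -
    have "(\<exists>u. mark K' x = Classical u) \<longleftrightarrow> (\<exists>u. mark K x = Classical u)" if "x \<in> double_points K" for x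
      using mk[rule_format, OF that] by (cases "mark K' x") auto
    then show ?thesis
      unfolding classical_crossings_def dp by blast
  qed
  have vel: "velocity K' t = \<rho>' t *\<^sub>R velocity K (g t)" for t
  proof -
    \<comment> \<open>Since \<open>g\<close> may jump, the chain rule is applied to
      \<open>\<rho>\<close> shifted by the fixed integer \<open>\<lfloor>\<rho> t\<rfloor>\<close>;
      by periodicity the composed curve is the same.\<close>
    have "((\<lambda>s. \<rho> s - of_int \<lfloor>\<rho> t\<rfloor>) has_vector_derivative \<rho>' t) (at t)"
      using der[of t] by (auto intro!: derivative_eq_intros simp flip: has_real_derivative_iff_has_vector_derivative)
    moreover have "(curve K has_vector_derivative velocity K (g t)) (at (\<rho> t - of_int \<lfloor>\<rho> t\<rfloor>))"
      using K.has_velocity[of "g t"] by (simp add: g_def frac_def)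
    ultimately have "(curve K \<circ> (\<lambda>s. \<rho> s - of_int \<lfloor>\<rho> t\<rfloor>) has_vector_derivative \<rho>' t *\<^sub>R velocity K (g t)) (at t)"
      by (rule vector_diff_chain_at)
    moreover have "curve K \<circ> (\<lambda>s. \<rho> s - of_int \<lfloor>\<rho> t\<rfloor>) = curve K'"
      using K.periodic_int[of _ "- \<lfloor>\<rho> t\<rfloor>"] by (auto simp: curve fun_eq_iff)
    ultimately show ?thesis
      unfolding velocity_def[of K'] by (simp add: vector_derivative_at)
  qed
  have sep: "separates (g a) (g b) (g t) \<longleftrightarrow> (separates a b t \<longleftrightarrow> \<lfloor>\<rho> a\<rfloor> = \<lfloor>\<rho> b\<rfloor>)"
    if "a \<in> {0..<1}" "b \<in> {0..<1}" "a \<noteq> b" "t \<in> {0..<1}" "t \<noteq> a" "t \<noteq> b" for a b t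
    unfolding g_def by (rule separates_frac[OF mono turn that])
  have g_eq: "g a = g b \<longleftrightarrow> a = b" if "a \<in> {0..<1}" "b \<in> {0..<1}" for a b
    using inj_onD[OF inj] that by blast
  show ?thesis
  proof (rule Qz_transfer[OF tw, where F = id and T = "{}"])
    fix c assume c: "c \<in> classical_crossings K"
    have cdp: "c \<in> double_points K'" "c \<in> double_points K"
      using c K.classical_subset dp by auto
    obtain a b where ab: "mark K' c = Classical a" "passages K' c = {a, b}" "a \<noteq> b"
      using c cc K'.classicalE by blast
    have ab01: "a \<in> {0..<1}" "b \<in> {0..<1}" and cab: "curve K' a = c" "curve K' b = c"
      using ab passages_memD[of a K' c] passages_memD[of b K' c] by auto
    have gab: "passages K c = {g a, g b}" "g a \<noteq> g b"
      using p ab ab01 g_eq by auto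
    have "mark K c = Classical (g a)"
      using mk cdp ab by (auto simp: g_def)
    moreover have "\<rho>' a * \<rho>' b > 0"
      using pos by simp
    ultimately show "crossing_sign K' (id c) = crossing_sign K c"
      using K.crossing_sign_eq[OF _ gab] K'.crossing_sign_eq[OF ab]
      by (simp add: vel wedge_scaleR zero_less_mult_iff[of "\<rho>' a * \<rho>' b"])
    show "linked K' (id c) (id d) \<longleftrightarrow> (linked K c d \<noteq> (c \<in> {} \<and> d \<in> {} \<and> c \<noteq> d))"
      if d: "d \<in> classical_crossings K" for d
    proof (cases "c = d")
      case False
      have "d \<in> double_points K'" using d K.classical_subset dp by auto
      then obtain q r where qr: "passages K' d = {q, r}" "q \<noteq> r"
        by (rule double_point_passages)
      have qr01: "q \<in> {0..<1}" "r \<in> {0..<1}"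
        using qr passages_memD[of q K' d] passages_memD[of r K' d] by auto
      have gqr: "passages K d = {g q, g r}" "g q \<noteq> g r"
        using p qr qr01 g_eq by auto
      have "q \<noteq> a" "q \<noteq> b" "r \<noteq> a" "r \<noteq> b"
        using passages_disjoint[OF False, of K'] ab qr by auto
      then show ?thesis
        using linked_iff[OF ab(2) qr] linked_iff[OF gab(1) gqr]
          sep[OF ab01 ab(3) qr01(1)] sep[OF ab01 ab(3) qr01(2)] by auto
    qed (use not_linked_self cdp in auto)
    have b01: "bars K' \<subseteq> {0..<1}" and fin: "finite (bars K')"
      and "\<forall>t \<in> bars K'. curve K' t \<notin> double_points K'" and bK: "bars K \<subseteq> {0..<1}"
      using K.diagram K'.diagram unfolding singular_twisted_knot_diagram_def by blast+
    then have off: "t \<noteq> a" "t \<noteq> b" if "t \<in> bars K'" for t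
      using cab cdp that by auto
    have gb: "bars K = g ` bars K'"
    proof -
      have "bars K \<subseteq> g ` {0..<1}"
        unfolding surj by (rule bK)
      then show ?thesis
        unfolding bars g_def by blast
    qed
    have card_b: "card (bars K) = card (bars K')"
      unfolding gb using inj b01 by (intro card_image) (rule inj_on_subset)
    have "bars K \<inter> component K 0 c = g ` {t \<in> bars K'. separates (g a) (g b) (g t)}"
      unfolding component_0[OF gab(1)] gb by auto
    also have "{t \<in> bars K'. separates (g a) (g b) (g t)} =
        (if \<lfloor>\<rho> a\<rfloor> = \<lfloor>\<rho> b\<rfloor> then bars K' \<inter> component K' 0 c else bars K' \<inter> component K' 1 c)"
      using sep[OF ab01 ab(3)] off b01 component_0[OF ab(2)] component_1[OF ab(2)] by auto
    finally have "card (bars K \<inter> component K 0 c) = card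
        (if \<lfloor>\<rho> a\<rfloor> = \<lfloor>\<rho> b\<rfloor> then bars K' \<inter> component K' 0 c else bars K' \<inter> component K' 1 c)"
      using b01 by (auto intro!: card_image inj_on_subset[OF inj])
    then have "bar_parity K 0 c = (if \<lfloor>\<rho> a\<rfloor> = \<lfloor>\<rho> b\<rfloor> then bar_parity K' 0 c else bar_parity K' 1 c)"
      by (simp add: bar_parity_def)
    \<comment> \<open>In the exchanged case, adding the total number of bars twice gives back the
      parity of component 0 of \<open>K'\<close>.\<close>
    moreover have "(n + (n + m) mod 2) mod 2 = m mod 2" for n m :: nat
      by (simp add: mod2_eq_if)
    moreover have "bar_parity K' 0 c mod 2 = bar_parity K' 0 c"
      by (simp add: bar_parity_def)
    ultimately show "{#bar_parity K' 0 (id c), bar_parity K' 1 (id c)#} = {#bar_parity K 0 c, bar_parity K 1 c#}"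
      using K.bar_parity_1[OF cdp(2)] K'.bar_parity_1[OF cdp(1)] card_b by (auto simp: add_mset_commute)
  qed (simp_all add: cc)
qed

section \<open>The extension to singular diagrams\<close>

lemma resolve_simps [simp]:
  "curve (resolve K x u) = curve K" "bars (resolve K x u) = bars K"
  "mark (resolve K x u) = (mark K)(x := Classical u)"
  by (simp_all add: resolve_def)

lemma passages_resolve [simp]: "passages (resolve K x u) = passages K"
  and velocity_resolve [simp]: "velocity (resolve K x u) = velocity K"
  by (intro ext; simp add: passages_def velocity_def)+

lemma double_points_resolve [simp]: "double_points (resolve K x u) = double_points K"
  by (simp add: double_points_def)

lemma component_resolve [simp]: "component (resolve K x u) = component K"
  by (intro ext) (simp add: component_def)

lemma linked_resolve [simp]: "linked (resolve K x u) = linked K"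
  by (intro ext) (simp add: linked_def)

text \<open>For a fixed vertex set only the times of passages and bars enter, never a mark.\<close>

lemma crossing_weight_resolve [simp]: "crossing_weight (resolve K x u) = crossing_weight K"
  by (intro ext) (simp add: crossing_weight_def bar_parity_def)

lemma crossing_sign_resolve: "y \<noteq> x \<Longrightarrow> crossing_sign (resolve K x u) y = crossing_sign K y"
  by (cases "mark K y") (simp_all add: crossing_sign_def)

lemma classical_crossings_resolve:
  "x \<in> double_points K \<Longrightarrow> classical_crossings (resolve K x u) = insert x (classical_crossings K)"
  by (auto simp: classical_crossings_def)

lemma singular_crossings_resolve:
  "singular_crossings (resolve K x u) = singular_crossings K - {x}"
  by (auto simp: singular_crossings_def)

lemma (in knot_diagram) knot_diagram_resolve:
  assumes "u \<in> passages K x"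
  shows "knot_diagram (resolve K x u)"
  using diagram assms unfolding knot_diagram_def singular_twisted_knot_diagram_def by simp

lemma Qz_resolve_diff:
  assumes K: "singular_twisted_knot_diagram K" and x: "x \<in> singular_crossings K" "passages K x = {u, u'}"
    and sign: "crossing_sign (resolve K x u) x = 1" "crossing_sign (resolve K x u') x = -1"
  shows "Qz (resolve K x u) - Qz (resolve K x u') =
    2 * crossing_weight K (insert x (classical_crossings K)) x"
proof -
  interpret knot_diagram K using K by (simp add: knot_diagram_def)
  let ?C = "classical_crossings K"
  interpret R: knot_diagram "resolve K x u" using x by (intro knot_diagram_resolve) auto
  interpret R': knot_diagram "resolve K x u'" using x by (intro knot_diagram_resolve) auto
  have xdp: "x \<in> double_points K" and xC: "x \<notin> ?C"
    using x by (auto simp: singular_crossings_def classical_crossings_def)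
  \<comment> \<open>The terms of the other crossings agree in both resolutions and cancel. The
    crossing \<open>x\<close> contributes its weight with sign 1 and with sign -1, whence the factor
    2.\<close>
  have "(\<Sum>c\<in>?C. of_int (crossing_sign (resolve K x v) c) * crossing_weight K (insert x ?C) c) =
      (\<Sum>c\<in>?C. of_int (crossing_sign K c) * crossing_weight K (insert x ?C) c)" for v
  proof (intro sum.cong refl)
    fix c assume "c \<in> ?C"
    then have "c \<noteq> x" using xC by auto
    then show "of_int (crossing_sign (resolve K x v) c) * crossing_weight K (insert x ?C) c =
        of_int (crossing_sign K c) * crossing_weight K (insert x ?C) c"
      by (simp add: crossing_sign_resolve)
  qed
  then show ?thesis
    unfolding R.Qz_eq R'.Qz_eq classical_crossings_resolve[OF xdp]
    using xC finite_classical sign by simp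
qed

text \<open>A closed form in place of a recursion over the singular crossings. A single singular
  crossing counts as a vertex, as it does in both of its resolutions; the sum over the one-element
  set avoids choosing its element.\<close>

definition Qz_extension :: "diagram \<Rightarrow> int poly poly" where
  "Qz_extension K =
     (if singular_crossings K = {} then Qz K
      else if card (singular_crossings K) = 1
      then 2 * (\<Sum>x\<in>singular_crossings K. crossing_weight K (classical_crossings K \<union> singular_crossings K) x)
      else 0)"

lemma finite_singular_crossings:
  "singular_twisted_knot_diagram K \<Longrightarrow> finite (singular_crossings K)"
  by (auto simp: singular_twisted_knot_diagram_def singular_crossings_def)

text \<open>
  The weights do not see which strand is over. Hence the first difference is twice the weight of the
  singular crossing, whatever the other crossings are, and the second difference vanishes.
\<close>

lemma vassiliev_extension_Qz: "vassiliev_extension Qz Qz_extension"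
  unfolding vassiliev_extension_def
proof (intro conjI allI impI)
  fix K assume "twisted_knot_diagram K"
  then show "Qz_extension K = Qz K"
    by (simp add: Qz_extension_def twisted_knot_diagram_def)
next
  fix K x u u'
  assume *: "singular_twisted_knot_diagram K \<and> x \<in> singular_crossings K \<and> passages K x = {u, u'} \<and>
    crossing_sign (resolve K x u) x = 1 \<and> crossing_sign (resolve K x u') x = -1"
  let ?S = "singular_crossings K"
  have fin: "finite ?S" using * finite_singular_crossings by blast
  have x: "x \<in> ?S" "x \<in> double_points K" using * by (auto simp: singular_crossings_def)
  show "Qz_extension K = Qz_extension (resolve K x u) - Qz_extension (resolve K x u')"
  proof (cases "card ?S = 1")
    case True
    then have S: "?S = {x}" using x by (auto simp: card_1_singleton_iff)
    show ?thesis
      using Qz_resolve_diff[of K x u u'] * unfolding Qz_extension_def singular_crossings_resolve S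
      by simp
  next
    case False
    then have "Qz_extension K = 0" using x by (auto simp: Qz_extension_def)
    moreover have "?S - {x} \<noteq> {}"
    proof
      assume "?S - {x} = {}"
      then have "?S = {x}" using x by auto
      then show False using False by simp
    qed
    \<comment> \<open>A singular crossing remains, so neither value falls under the case
      \<open>Qz\<close>. Both resolutions have the same classical crossings, the same singular
      crossings and the same weights.\<close>
    then have "Qz_extension (resolve K x u) = Qz_extension (resolve K x u')"
      using x by (simp add: Qz_extension_def singular_crossings_resolve classical_crossings_resolve)
    ultimately show ?thesis by simp
  qed
qed

lemma vassiliev_order_le_Qz: "vassiliev_order_le 1 Qz"
  unfolding vassiliev_order_le_def
  using vassiliev_extension_Qz by (intro exI[of _ Qz_extension]) (auto simp: Qz_extension_def)

section \<open>A singular figure eight with nonzero derivative\<close>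

text \<open>
  The second coordinate is \<open>sin (4 \<pi> t)\<close>. The only double point is passed at the times \<open>0\<close> and \<open>1/2\<close>,
  so each loop carries one bar.
\<close>

definition figure_eight :: diagram where
  "figure_eight = \<lparr>curve = (\<lambda>t. Complex (sin (2 * pi * t)) (2 * sin (2 * pi * t) * cos (2 * pi * t))),
     mark = (\<lambda>_. Singular), bars = {1/4, 3/4}\<rparr>"

lemma sin_eq_0_cases:
  assumes "t \<in> {0..<1}" "sin (2 * pi * t) = 0"
  shows "t = 0 \<or> t = 1/2"
proof -
  obtain i :: int where "2 * pi * t = of_int i * pi"
    using assms(2) by (auto simp: sin_zero_iff_int2)
  then have i: "2 * t = of_int i" by simp
  then have "0 \<le> i" "i < 2" using assms(1) by auto
  then have "i = 0 \<or> i = 1" by auto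
  then show ?thesis using i by auto
qed

lemma sin_cos_2pi_inj:
  assumes "s \<in> {0..<1}" "t \<in> {0..<1}" "sin (2 * pi * s) = sin (2 * pi * t)" "cos (2 * pi * s) = cos (2 * pi * t)"
  shows "s = t"
proof -
  obtain n :: int where "2 * pi * s = 2 * pi * t + 2 * pi * n"
    using assms(3,4) sin_cos_eq_iff by blast
  then have "2 * pi * s = 2 * pi * (t + n)" by (simp only: distrib_left)
  then have n: "s = t + n" by simp
  then have "n = 0" using assms(1,2) by auto
  then show ?thesis using n by simp
qed

lemma passages_figure_eight:
  assumes "s \<in> passages figure_eight x" "t \<in> passages figure_eight x" "s \<noteq> t"
  shows "x = 0" "{s, t} = {0, 1/2}"
proof -
  have st: "s \<in> {0..<1}" "t \<in> {0..<1}"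
    and sin: "sin (2 * pi * s) = sin (2 * pi * t)"
    and mul: "sin (2 * pi * s) * cos (2 * pi * s) = sin (2 * pi * t) * cos (2 * pi * t)"
    and x: "x = Complex (sin (2 * pi * s)) (2 * sin (2 * pi * s) * cos (2 * pi * s))"
    using assms by (auto simp: passages_def figure_eight_def)
  \<comment> \<open>If the sine were nonzero, it could be cancelled in the second coordinate; sine
    and cosine would then agree at \<open>s\<close> and \<open>t\<close>.\<close>
  have "sin (2 * pi * s) = 0"
    using sin mul sin_cos_2pi_inj[OF st] assms(3) by auto
  then show "x = 0" "{s, t} = {0, 1/2}"
    using sin sin_eq_0_cases[OF st(1)] sin_eq_0_cases[OF st(2)] assms(3) x
    by (auto simp: complex_eq_iff)
qed

lemma passages_figure_eight_0: "passages figure_eight 0 = {0, 1/2}"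
proof
  show "passages figure_eight 0 \<subseteq> {0, 1/2}"
    using sin_eq_0_cases unfolding passages_def figure_eight_def by (fastforce simp: complex_eq_iff)
qed (auto simp: passages_def figure_eight_def complex_eq_iff)

lemma card_passages_figure_eight: "finite (passages figure_eight x) \<and> card (passages figure_eight x) \<le> 2"
proof (cases "x = 0")
  case False
  then have "s = t" if "s \<in> passages figure_eight x" "t \<in> passages figure_eight x" for s t
    using passages_figure_eight(1)[OF that] by auto
  then have "passages figure_eight x = {} \<or> (\<exists>s. passages figure_eight x = {s})"
    by blast
  then show ?thesis by auto
qed (simp add: passages_figure_eight_0)

lemma double_points_figure_eight: "double_points figure_eight = {0}"
proof -
  have "x = 0" if "card (passages figure_eight x) = 2" for x
    using that passages_figure_eight(1) by (auto simp: card_2_iff)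
  then show ?thesis
    by (auto simp: double_points_def passages_figure_eight_0)
qed

lemma figure_eight_derivative:
  "(curve figure_eight has_vector_derivative
     Complex (2 * pi * cos (2 * pi * t)) (4 * pi * ((cos (2 * pi * t))\<^sup>2 - (sin (2 * pi * t))\<^sup>2))) (at t)"
proof -
  have "((\<lambda>t. Complex (sin (2 * pi * t)) (2 * sin (2 * pi * t) * cos (2 * pi * t))) has_vector_derivative
     Complex (2 * pi * cos (2 * pi * t)) (4 * pi * ((cos (2 * pi * t))\<^sup>2 - (sin (2 * pi * t))\<^sup>2))) (at t)"
    unfolding has_vector_derivative_complex_iff
    by (auto intro!: derivative_eq_intros simp: power2_eq_square algebra_simps)
  then show ?thesis by (simp add: figure_eight_def)
qed

lemma velocity_figure_eight:
  "velocity figure_eight t =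
     Complex (2 * pi * cos (2 * pi * t)) (4 * pi * ((cos (2 * pi * t))\<^sup>2 - (sin (2 * pi * t))\<^sup>2))"
  unfolding velocity_def by (rule vector_derivative_at[OF figure_eight_derivative])

lemma singular_figure_eight: "singular_twisted_knot_diagram figure_eight"
  unfolding singular_twisted_knot_diagram_def
proof (intro conjI allI ballI impI)
  show "curve figure_eight (t + 1) = curve figure_eight t" for t
    by (simp add: figure_eight_def distrib_left)
  show "curve figure_eight C1_differentiable_on UNIV"
    unfolding C1_differentiable_on_def
    using figure_eight_derivative
    by (intro exI[of _ "\<lambda>t. Complex (2 * pi * cos (2 * pi * t)) (4 * pi * ((cos (2 * pi * t))\<^sup>2 - (sin (2 * pi * t))\<^sup>2))"])
      (auto intro!: continuous_intros continuous_on_Complex)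
  \<comment> \<open>If both coordinates vanished, cosine and sine would vanish together.\<close>
  show "velocity figure_eight t \<noteq> 0" for t
    using sin_zero_abs_cos_one[of "2 * pi * t"] by (auto simp: velocity_figure_eight complex_eq_iff)
  show "finite (passages figure_eight x)" "card (passages figure_eight x) \<le> 2" for x
    using card_passages_figure_eight by blast+
  show "finite (double_points figure_eight)"
    by (simp add: double_points_figure_eight)
  show "wedge (velocity figure_eight t) (velocity figure_eight t') \<noteq> 0"
    if "x \<in> double_points figure_eight" "t \<in> passages figure_eight x" "t' \<in> passages figure_eight x" "t \<noteq> t'"
    for x t t'
  proof -
    \<comment> \<open>The tangents at the times \<open>0\<close> and \<open>1/2\<close> are
      \<open>(2 pi, 4 pi)\<close> and \<open>(-2 pi, 4 pi)\<close>.\<close>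
    have "wedge (velocity figure_eight 0) (velocity figure_eight (1/2)) \<noteq> 0"
      "wedge (velocity figure_eight (1/2)) (velocity figure_eight 0) \<noteq> 0"
      by (simp_all add: velocity_figure_eight wedge_def)
    moreover have "t = 0 \<and> t' = 1/2 \<or> t = 1/2 \<and> t' = 0"
      using that unfolding double_points_figure_eight by (auto simp: passages_figure_eight_0)
    ultimately show ?thesis
      by blast
  qed
  show "u \<in> passages figure_eight x" if "mark figure_eight x = Classical u" for x u
    using that by (simp add: figure_eight_def)
  show "finite (bars figure_eight)" "bars figure_eight \<subseteq> {0..<1}"
    by (auto simp: figure_eight_def)
  show "curve figure_eight t \<notin> double_points figure_eight" if "t \<in> bars figure_eight" for t
  proof
    assume "curve figure_eight t \<in> double_points figure_eight"
    moreover have t: "t = 1/4 \<or> t = 3/4" using that by (auto simp: figure_eight_def)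
    ultimately have "t \<in> passages figure_eight 0"
      by (auto simp: double_points_figure_eight passages_def)
    then show False using t by (auto simp: passages_figure_eight_0)
  qed
qed

lemma singular_crossings_figure_eight: "singular_crossings figure_eight = {0}"
  unfolding singular_crossings_def double_points_figure_eight by (auto simp: figure_eight_def)

lemma Qz_extension_figure_eight: "Qz_extension figure_eight \<noteq> 0"
proof -
  interpret knot_diagram figure_eight
    by unfold_locales (rule singular_figure_eight)
  have cc: "classical_crossings figure_eight = {}"
    by (auto simp: classical_crossings_def figure_eight_def)
  have "\<not> linked figure_eight 0 0"
    by (rule not_linked_self) (simp add: double_points_figure_eight)
  then have e: "exponent {0} (linked figure_eight) 0 = 0"
    by (simp add: exponent_def even_vertices_def cong: conj_cong)
  have "bars figure_eight \<inter> component figure_eight 0 0 = {1/4}"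
    unfolding component_0[OF passages_figure_eight_0] by (auto simp: figure_eight_def separates_def)
  then have p0: "bar_parity figure_eight 0 0 = 1"
    by (simp add: bar_parity_def)
  have "card (bars figure_eight) = 2"
    by (simp add: figure_eight_def)
  then have p1: "bar_parity figure_eight 1 0 = 1"
    using bar_parity_1[of 0] p0 by (simp add: double_points_figure_eight)
  \<comment> \<open>The value is \<open>2 * ((var_t - 1) * (var_t - 1))\<close> in the integral
    domain \<open>int poly poly\<close>, so a nonzero factor suffices.\<close>
  have "var_t - 1 \<noteq> 0"
    by (simp add: var_t_def one_pCons)
  then show ?thesis
    unfolding Qz_extension_def singular_crossings_figure_eight cc
    by (simp add: crossing_weight_def weight_def e p0 p1[unfolded One_nat_def])
qed

section \<open>Invariance under all moves, and order one\<close>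

lemma twisted_knot_invariant_Qz: "twisted_knot_invariant Qz"
  unfolding twisted_knot_invariant_def
proof (intro allI impI; elim conjE)
  fix K K' assume tw: "twisted_knot_diagram K" "twisted_knot_diagram K'" and mv: "twisted_move K K'"
  have local: "local_move K K' B As" if "local_change B As K K'" for B As
    using that tw twisted_imp_knot_diagram by (simp add: local_move_def local_move_axioms_def)
  from mv consider "plane_isotopy K K'" | "reparametrization K K'" | "reidemeister1 K K'"
    | "reidemeister2 K K'" | "reidemeister3 K K'" | "virtual1 K K'" | "virtual2 K K'"
    | "virtual3 K K'" | "virtual4 K K'" | "twisted1 K K'" | "twisted2 K K'" | "twisted3 K K'"
    unfolding twisted_move_def by blast
  then show "Qz K = Qz K'"
  proof cases
    case 1
    with tw show ?thesis by (rule Qz_plane_isotopy)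
  next
    case 2
    with tw show ?thesis by (rule Qz_reparametrization)
  next
    case 3
    then obtain B A x where *: "local_change B [A] K K'" "no_bars K [A]" "no_bars K' [A]"
        "double_points K \<inter> B = {}" "double_points K' \<inter> B = {x}" "x \<in> classical_crossings K'"
      unfolding reidemeister1_def by (elim exE conjE)
    show ?thesis
      by (rule local_move.Qz_reidemeister1[OF local[OF *(1)] refl *(2-6)])
  next
    case 4
    then obtain B As t s where big: "bigon B As t s K K'"
      and mk: "mark K' (curve K' t) = Classical t" "mark K' (curve K' s) = Classical s"
      and sign: "crossing_sign K' (curve K' t) = - crossing_sign K' (curve K' s)"
      unfolding reidemeister2_def by (elim exE conjE)
    from big obtain A0 A1 where As: "As = [A0, A1]" and lc: "local_change B As K K'"
      and nb: "no_bars K As" "no_bars K' As" and dp: "double_points K \<inter> B = {}"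
      and arc: "t \<in> A0" "s \<in> A0" and ne: "curve K' t \<noteq> curve K' s"
      and img: "curve K' t \<in> curve K' ` A1" "curve K' s \<in> curve K' ` A1"
      and dp': "double_points K' \<inter> B = {curve K' t, curve K' s}"
      unfolding bigon_def by (elim exE conjE)
    from img obtain t1 s1 where "t1 \<in> A1" "curve K' t1 = curve K' t" "s1 \<in> A1" "curve K' s1 = curve K' s"
      by (metis imageE)
    then show ?thesis
      using local_move.Qz_reidemeister2[OF local[OF lc] As nb dp dp' mk(1) arc(1) _ refl _ mk(2) arc(2) _ refl _ ne sign]
      by blast
  next
    case 5
    then obtain B As s s' where *: "triangle_move B As s s' K K'"
        "\<forall>(i, j) \<in> {(0, 1), (0, 2), (1, 2)}.
           mark K (curve K (s i j)) = Classical (s i j) \<and>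
           mark K' (curve K' (s' i j)) = Classical (s' i j) \<and>
           crossing_sign K (curve K (s i j)) = crossing_sign K' (curve K' (s' i j))"
      unfolding reidemeister3_def by (elim exE conjE)
    have "local_change B As K K'"
      using *(1) unfolding triangle_move_def by (rule conjunct1)
    then show ?thesis
      using local_move.Qz_reidemeister3[OF local tw *] by blast
  next
    case 6
    then obtain B A x where *: "local_change B [A] K K'" "no_bars K [A]" "no_bars K' [A]"
        "double_points K \<inter> B = {}" "double_points K' \<inter> B = {x}" "mark K' x = Virtual"
      unfolding virtual1_def by (elim exE conjE)
    show ?thesis
      by (rule local_move.Qz_local_none[OF local[OF *(1)] tw *(2,3)])
        (use *(4-6) in \<open>simp_all add: classical_crossings_Int\<close>)
  next
    case 7
    then obtain B As t s where big: "bigon B As t s K K'"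
      and mk: "mark K' (curve K' t) = Virtual" "mark K' (curve K' s) = Virtual"
      unfolding virtual2_def by (elim exE conjE)
    from big obtain A0 A1 where lc: "local_change B As K K'"
      and nb: "no_bars K As" "no_bars K' As" and dp: "double_points K \<inter> B = {}"
      and dp': "double_points K' \<inter> B = {curve K' t, curve K' s}"
      unfolding bigon_def by (elim exE conjE)
    show ?thesis
      by (rule local_move.Qz_local_none[OF local[OF lc] tw nb])
        (use dp dp' mk in \<open>auto simp: classical_crossings_Int\<close>)
  next
    case 8
    then obtain B As s s' where mv: "triangle_move B As s s' K K'" and
        mk: "\<forall>(i, j) \<in> {(0, 1), (0, 2), (1, 2)}.
           mark K (curve K (s i j)) = Virtual \<and> mark K' (curve K' (s' i j)) = Virtual"
      unfolding virtual3_def by (elim exE conjE)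
    have lc: "local_change B As K K'"
      using mv unfolding triangle_move_def by (rule conjunct1)
    note tri = triangle_moveD[OF mv]
    show ?thesis
      by (rule local_move.Qz_local_none[OF local[OF lc] tw triangleD(2)[OF tri(1)] triangleD(2)[OF tri(2)]])
        (use mk in \<open>auto simp: classical_crossings_Int triangleD(4)[OF tri(1)] triangleD(4)[OF tri(2)]\<close>)
  next
    case 9
    then obtain B As s s' where *: "triangle_move B As s s' K K'"
        "mark K (curve K (s 0 1)) = Classical (s 0 1)"
        "mark K' (curve K' (s' 0 1)) = Classical (s' 0 1)"
        "crossing_sign K (curve K (s 0 1)) = crossing_sign K' (curve K' (s' 0 1))"
        "\<forall>(i, j) \<in> {(0, 2), (1, 2)}.
           mark K (curve K (s i j)) = Virtual \<and> mark K' (curve K' (s' i j)) = Virtual"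
      unfolding virtual4_def by (elim exE conjE)
    have "local_change B As K K'"
      using *(1) unfolding triangle_move_def by (rule conjunct1)
    then show ?thesis
      using local_move.Qz_virtual4[OF local tw *] by blast
  next
    case 10
    with tw show ?thesis by (rule Qz_twisted1)
  next
    case 11
    with tw show ?thesis by (rule Qz_twisted2)
  next
    case 12
    then obtain B A0 A1 t0 t1 a0 b0 a1 b1 p0 q0 r0 p1 q1 r1 where
        lc: "local_change B [A0, A1] K K'"
      and t: "t0 \<in> A0" "t1 \<in> A1" "curve K t0 = curve K t1"
      and dp: "double_points K \<inter> B = {curve K t0}" "mark K (curve K t0) = Classical t0"
      and b: "bars K \<inter> A0 = {a0, b0}" "a0 < t0" "t0 < b0" "bars K \<inter> A1 = {a1, b1}" "a1 < t1" "t1 < b1"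
      and nb: "no_bars K' [A0, A1]"
      and sub: "{p0, q0, r0} \<subseteq> A0" "{p1, q1, r1} \<subseteq> A1" and q: "curve K' q0 = curve K' q1"
      and dp': "double_points K' \<inter> B = {curve K' p0, curve K' q0, curve K' r0}"
        "mark K' (curve K' p0) = Virtual" "mark K' (curve K' r0) = Virtual"
        "mark K' (curve K' q0) = Classical q1"
      and sign: "crossing_sign K' (curve K' q0) = crossing_sign K (curve K t0)"
      unfolding twisted3_def by (elim exE conjE)
    have "q0 \<in> A0" "q1 \<in> A1" using sub by auto
    then show ?thesis
      using local_move.Qz_twisted3[OF local[OF lc] tw refl t dp b nb _ _ q dp' sign] by blast
  qed
qed

theorem theorem6p7:
  shows "vassiliev_invariant_of_order_one Qz"
  unfolding vassiliev_invariant_of_order_one_def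
proof (intro conjI exI)
  show "twisted_knot_invariant Qz"
    by (rule twisted_knot_invariant_Qz)
  show "vassiliev_order_le 1 Qz"
    by (rule vassiliev_order_le_Qz)
  show "vassiliev_extension Qz Qz_extension"
    by (rule vassiliev_extension_Qz)
  show "singular_twisted_knot_diagram figure_eight"
    by (rule singular_figure_eight)
  show "card (singular_crossings figure_eight) = 1"
    by (simp add: singular_crossings_figure_eight)
  show "Qz_extension figure_eight \<noteq> 0"
    by (rule Qz_extension_figure_eight)
qed

end
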